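(* Let $\mathbb{D}=(\mathbb{R}/L\mathbb{Z})^d$, let $\rho$ be a probability density on $\mathbb{D}$ bounded away from zero and bounded above, let $x^1,\dots,x^M\in\mathbb{D}$, let $Z_0>0$, $\varepsilon>0$ and $\zeta=Z_0\varepsilon^{1/2}$, and set $$\delta:=\big\|\mathcal{K}^M_{\varepsilon/2}-\mathcal{K}_{\varepsilon/2}\big\|_{H^\infty(\mathbb{D}_\zeta)\to C^0(\mathbb{D})}.$$ Then $$\big\|\mathcal{K}^M_\varepsilon-\mathcal{K}_\varepsilon\big\|_{H^\infty(\mathbb{D}_\zeta)\to H^\infty(\mathbb{D}_\zeta)}\le e^{2dZ_0^2}\,\delta.$$
   Context: $g_\varepsilon(x)=(2\pi\varepsilon)^{-d/2}e^{-\|x\|^2/2\varepsilon}$ and $g_{\varepsilon,L}(x)=\sum_{\mathbf j\in\mathbb{Z}^d}g_\varepsilon(x+L\mathbf j)$. The kernel operators are $$(\mathcal{K}_\varepsilon\phi)(x)=\int_{\mathbb{D}}g_{\varepsilon,L}(x-y)\phi(y)\rho(y)\,dy,\qquad(\mathcal{K}^M_\varepsilon\phi)(x)=\frac1M\sum_{i=1}^Mg_{\varepsilon,L}(x-x^i)\phi(x^i),$$ where for $x$ in a complex neighbourhood of $\mathbb{D}$ the kernel $g_{\varepsilon,L}$ is extended analytically (with $\|x\|^2$ replaced by $\sum_jx_j^2$). For $\zeta>0$, $\mathbb{D}_\zeta=\{x+iz:x\in\mathbb{D},z\in[-\zeta,\zeta]^d\}$ and $H^\infty(\mathbb{D}_\zeta)$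 is the space of functions continuous on $\mathbb{D}_\zeta$ and analytic in its interior, with norm $\|\phi\|_\zeta=\sup_{z\in\mathbb{D}_\zeta}|\phi(z)|$. *)

theory Defs
  imports "HOL-Analysis.Analysis"
begin

text \<open>
  Functions on the torus \<open>\<real>\<^sup>d / L\<int>\<^sup>d\<close> are represented by functions on \<open>\<real>\<^sup>d\<close> that are periodic with
  respect to \<open>L\<int>\<^sup>d\<close>, and functions on its complex neighbourhoods by functions on strips in \<open>\<complex>\<^sup>d\<close>
  with the same periods; \<open>d = CARD('n)\<close>.
\<close>

definition period :: "real \<Rightarrow> int ^ 'n \<Rightarrow> 'a::real_algebra_1 ^ 'n" where
  "period L k = (\<chi> i. of_real (L * of_int (k $ i)))"

definition periodic_on :: "real \<Rightarrow> ('a::real_algebra_1 ^ 'n) set \<Rightarrow> ('a ^ 'n \<Rightarrow> 'b) \<Rightarrow> bool" where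
  "periodic_on L S f \<longleftrightarrow> (\<forall>x\<in>S. \<forall>k. f (x + period L k) = f x)"

definition cvec :: "real ^ 'n \<Rightarrow> complex ^ 'n" where
  "cvec x = (\<chi> i. of_real (x $ i))"

definition fund_cube :: "real \<Rightarrow> (real ^ 'n) set" where
  "fund_cube L = cbox 0 (\<chi> i. L)"

definition torus_density :: "real \<Rightarrow> (real ^ 'n \<Rightarrow> real) \<Rightarrow> bool" where
  "torus_density L \<rho> \<longleftrightarrow> \<rho> \<in> borel_measurable borel \<and> periodic_on L UNIV \<rho> \<and>
     (AE y in lborel. 0 \<le> \<rho> y) \<and> (LINT y:fund_cube L|lborel. \<rho> y) = 1"

text \<open>The argument is squared without conjugation: this is the entire extension of the real Gaussian.\<close>

definition gauss :: "real \<Rightarrow> complex ^ 'n \<Rightarrow> complex" where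
  "gauss \<epsilon> z = of_real ((2 * pi * \<epsilon>) powr (- real CARD('n) / 2)) *
     exp (- (\<Sum>i\<in>UNIV. (z $ i)\<^sup>2) / of_real (2 * \<epsilon>))"

lemma gauss_cvec:
  fixes x :: "real ^ 'n"
  shows "gauss \<epsilon> (cvec x) =
    of_real ((2 * pi * \<epsilon>) powr (- real CARD('n) / 2) * exp (- (norm x)\<^sup>2 / (2 * \<epsilon>)))"
proof -
  have "(norm x)\<^sup>2 = (\<Sum>i\<in>UNIV. (x $ i)\<^sup>2)"
    by (simp add: norm_vec_def L2_set_def sum_nonneg)
  then show ?thesis
    by (simp add: gauss_def cvec_def exp_of_real[symmetric])
qed

definition gauss_per :: "real \<Rightarrow> real \<Rightarrow> complex ^ 'n \<Rightarrow> complex" where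
  "gauss_per \<epsilon> L z = (\<Sum>\<^sub>\<infinity>k\<in>UNIV. gauss \<epsilon> (z + period L k))"

definition kernel_op ::
  "real \<Rightarrow> (real ^ 'n \<Rightarrow> real) \<Rightarrow> real \<Rightarrow> (complex ^ 'n \<Rightarrow> complex) \<Rightarrow> complex ^ 'n \<Rightarrow> complex" where
  "kernel_op L \<rho> \<epsilon> \<phi> z =
     (LINT y:fund_cube L|lborel. gauss_per \<epsilon> L (z - cvec y) * \<phi> (cvec y) * of_real (\<rho> y))"

definition empirical_op ::
  "real \<Rightarrow> nat \<Rightarrow> (nat \<Rightarrow> real ^ 'n) \<Rightarrow> real \<Rightarrow> (complex ^ 'n \<Rightarrow> complex) \<Rightarrow> complex ^ 'n \<Rightarrow> complex" where
  "empirical_op L M X \<epsilon> \<phi> z =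
     (1 / of_nat M) * (\<Sum>i=1..M. gauss_per \<epsilon> L (z - cvec (X i)) * \<phi> (cvec (X i)))"

definition op_diff ::
  "real \<Rightarrow> (real ^ 'n \<Rightarrow> real) \<Rightarrow> nat \<Rightarrow> (nat \<Rightarrow> real ^ 'n) \<Rightarrow> real \<Rightarrow>
     (complex ^ 'n \<Rightarrow> complex) \<Rightarrow> complex ^ 'n \<Rightarrow> complex" where
  "op_diff L \<rho> M X \<epsilon> \<phi> z = empirical_op L M X \<epsilon> \<phi> z - kernel_op L \<rho> \<epsilon> \<phi> z"

definition strip :: "real \<Rightarrow> (complex ^ 'n) set" where
  "strip \<zeta> = {z. \<forall>i. Im (z $ i) \<in> {-\<zeta>..\<zeta>}}"

text \<open>Holomorphy in several variables: the total derivative exists and is complex-linear.\<close>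

definition mv_holomorphic_on :: "(complex ^ 'n \<Rightarrow> complex) \<Rightarrow> (complex ^ 'n) set \<Rightarrow> bool" where
  "mv_holomorphic_on f S \<longleftrightarrow>
     (\<forall>z\<in>S. \<exists>D. (f has_derivative D) (at z within S) \<and> (\<forall>c v. D (c *s v) = c * D v))"

text \<open>Only the values on the strip matter; elements of the space are not constrained outside it.\<close>

definition H_inf :: "real \<Rightarrow> real \<Rightarrow> (complex ^ 'n \<Rightarrow> complex) set" where
  "H_inf L \<zeta> = {\<phi>. periodic_on L (strip \<zeta>) \<phi> \<and> continuous_on (strip \<zeta>) \<phi> \<and>
     mv_holomorphic_on \<phi> (interior (strip \<zeta>))}"

definition C0_torus :: "real \<Rightarrow> (real ^ 'n \<Rightarrow> complex) set" where
  "C0_torus L = {f. periodic_on L UNIV f \<and> continuous_on UNIV f}"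

definition sup_norm :: "'a set \<Rightarrow> ('a \<Rightarrow> complex) \<Rightarrow> ennreal" where
  "sup_norm S f = (SUP x\<in>S. ennreal (norm (f x)))"

text \<open>
  The norm of an operator from \<open>X\<close>, with the supremum norm over \<open>S\<close>, to functions with the supremum
  norm over \<open>S'\<close>. It takes values in \<open>[0,\<infinity>]\<close>, so an unbounded operator has norm \<open>\<infinity>\<close>.
\<close>

definition op_norm ::
  "('a \<Rightarrow> complex) set \<Rightarrow> 'a set \<Rightarrow> 'b set \<Rightarrow> (('a \<Rightarrow> complex) \<Rightarrow> 'b \<Rightarrow> complex) \<Rightarrow> ennreal" where
  "op_norm X S S' T = (SUP \<phi>\<in>{\<phi>\<in>X. sup_norm S \<phi> \<le> 1}. sup_norm S' (T \<phi>))"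

end

theory Submission
  imports Defs "HOL-Probability.Characteristic_Functions"
begin

text \<open>
  The heat semigroup property says that a Gaussian of variance \<open>\<epsilon>\<close> is the convolution of two
  Gaussians of variance \<open>\<epsilon> / 2\<close>. It survives when one argument is complex: for \<open>z \<in> \<complex>\<^sup>d\<close> and
  \<open>x, y \<in> \<real>\<^sup>d\<close>, completing the square gives
  \<open>g\<^sub>\<epsilon>\<^sub>/\<^sub>2(z - x) g\<^sub>\<epsilon>\<^sub>/\<^sub>2(x - y) = g\<^sub>\<epsilon>(z - y) g\<^sub>\<epsilon>\<^sub>/\<^sub>4((z + y) / 2 - x)\<close>
  (\<open>gauss_mult\<close>), and a Gaussian along a complex translate of \<open>\<real>\<^sup>d\<close> still has integral 1
  (\<open>has_bochner_integral_gauss\<close>). Summing over the lattice and using Fubini,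
  the difference \<open>T\<^sub>\<epsilon>\<close> of the empirical and the exact operator satisfies
  \<open>(T\<^sub>\<epsilon> \<phi>)(z) = \<integral> g\<^sub>\<epsilon>\<^sub>/\<^sub>2(z - x) (T\<^sub>\<epsilon>\<^sub>/\<^sub>2 \<phi>)(x) dx\<close>,
  an integral over real points only (\<open>op_diff_smoothing\<close>).

  The norm bound follows at once: \<open>\<bar>g\<^sub>\<epsilon>\<^sub>/\<^sub>2(z - x)\<bar>\<close> equals \<open>exp(\<bar>Im z\<bar>\<^sup>2 / \<epsilon>)\<close> times the
  real Gaussian at \<open>Re z - x\<close>, so its integral over \<open>x\<close> is \<open>exp(\<bar>Im z\<bar>\<^sup>2 / \<epsilon>)\<close>, which on the strip
  of half-width \<open>Z\<^sub>0 \<epsilon>\<^sup>1\<^sup>/\<^sup>2\<close> is at most \<open>exp(d Z\<^sub>0\<^sup>2) \<le> exp(2 d Z\<^sub>0\<^sup>2)\<close>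
  (\<open>norm_gauss_smoothing_le\<close>).

  The same formula yields the regularity claims. Up to the factor \<open>exp(- z\<^sup>2 / \<epsilon>)\<close>, the smoothing of a
  bounded function is a Laplace transform of a function with Gaussian decay, hence entire
  (\<open>gauss_smoothing_complex_differentiable\<close>). So \<open>T\<^sub>\<epsilon> \<phi>\<close> is entire for every \<open>\<epsilon> > 0\<close> as soon as
  \<open>T\<^sub>\<epsilon>\<^sub>/\<^sub>2 \<phi>\<close> is bounded and measurable on \<open>\<real>\<^sup>d\<close>; applied at \<open>\<epsilon>\<close> and at \<open>\<epsilon> / 2\<close> this gives
  membership in the target spaces. Boundedness, and with it \<open>\<delta> < \<infinity>\<close>, comes from the boundedness of the
  periodised Gaussian on \<open>\<real>\<^sup>d\<close>.
\<close>

section \<open>The complex Gaussian\<close>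

definition gauss1 :: "real \<Rightarrow> complex \<Rightarrow> complex" where
  "gauss1 \<eta> w = of_real ((2 * pi * \<eta>) powr (- 1 / 2)) * exp (- w\<^sup>2 / of_real (2 * \<eta>))"

lemma gauss_eq_prod:
  fixes z :: "complex ^ 'n"
  assumes "\<eta> > 0"
  shows "gauss \<eta> z = (\<Prod>i\<in>UNIV. gauss1 \<eta> (z $ i))"
proof -
  have "(2 * pi * \<eta>) powr (- real CARD('n) / 2) = ((2 * pi * \<eta>) powr (- 1 / 2)) ^ CARD('n)"
    using assms by (simp add: powr_power)
  then show ?thesis
    by (simp add: gauss_def gauss1_def prod.distrib exp_sum[symmetric] sum_divide_distrib sum_negf)
qed

lemma cvec_nth [simp]: "cvec x $ i = of_real (x $ i)"
  by (simp add: cvec_def)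

lemma cvec_add: "cvec (x + y) = cvec x + cvec y"
  and cvec_diff: "cvec (x - y) = cvec x - cvec y"
  by (simp_all add: vec_eq_iff)

lemma continuous_on_cvec [continuous_intros]:
  "continuous_on S f \<Longrightarrow> continuous_on S (\<lambda>x. cvec (f x))"
  unfolding cvec_def by (intro continuous_intros)

lemma continuous_on_gauss [continuous_intros]:
  assumes "\<eta> > 0" "continuous_on S f"
  shows "continuous_on S (\<lambda>x. gauss \<eta> (f x))"
  unfolding gauss_def using assms by (intro continuous_intros) auto

text \<open>
  Completing the square in \<open>x\<close>: \<open>(w - x)\<^sup>2 + (x - y)\<^sup>2 = (w - y)\<^sup>2 / 2 + 2 ((w + y) / 2 - x)\<^sup>2\<close>. This is a
  polynomial identity, so it holds for complex arguments.
\<close>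

lemma gauss1_mult:
  assumes "\<epsilon> > 0"
  shows "gauss1 (\<epsilon> / 2) (w - x) * gauss1 (\<epsilon> / 2) (x - y) =
    gauss1 \<epsilon> (w - y) * gauss1 (\<epsilon> / 4) ((w + y) / 2 - x)"
proof -
  have "(pi * \<epsilon>) powr (- 1 / 2) * (pi * \<epsilon>) powr (- 1 / 2) =
      ((2 * pi * \<epsilon>) * (pi * \<epsilon> / 2)) powr (- 1 / 2)"
    using assms by (subst powr_mult[symmetric]) (simp_all add: field_simps)
  also have "\<dots> = (2 * pi * \<epsilon>) powr (- 1 / 2) * (pi * \<epsilon> / 2) powr (- 1 / 2)"
    using assms by (subst powr_mult) simp_all
  finally have c: "(pi * \<epsilon>) powr (- 1 / 2) * (pi * \<epsilon>) powr (- 1 / 2) =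
      (2 * pi * \<epsilon>) powr (- 1 / 2) * (pi * \<epsilon> / 2) powr (- 1 / 2)" .
  have e: "- (w - x)\<^sup>2 / of_real \<epsilon> + - (x - y)\<^sup>2 / of_real \<epsilon> =
      - (w - y)\<^sup>2 / of_real (2 * \<epsilon>) + - ((w + y) / 2 - x)\<^sup>2 / of_real (\<epsilon> / 2)"
    using assms by (simp add: field_simps power2_eq_square)
  have "gauss1 (\<epsilon> / 2) (w - x) * gauss1 (\<epsilon> / 2) (x - y) =
      of_real ((pi * \<epsilon>) powr (- 1 / 2) * (pi * \<epsilon>) powr (- 1 / 2)) *
      exp (- (w - x)\<^sup>2 / of_real \<epsilon> + - (x - y)\<^sup>2 / of_real \<epsilon>)"
    by (simp add: gauss1_def exp_add[symmetric])
  also have "\<dots> = gauss1 \<epsilon> (w - y) * gauss1 (\<epsilon> / 4) ((w + y) / 2 - x)"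
    unfolding e exp_add c by (simp add: gauss1_def)
  finally show ?thesis .
qed

lemma gauss_mult:
  fixes z x y :: "complex ^ 'n"
  assumes "\<epsilon> > 0"
  shows "gauss (\<epsilon> / 2) (z - x) * gauss (\<epsilon> / 2) (x - y) =
    gauss \<epsilon> (z - y) * gauss (\<epsilon> / 4) ((1 / 2) *s (z + y) - x)"
proof -
  have "gauss1 (\<epsilon> / 2) ((z - x) $ i) * gauss1 (\<epsilon> / 2) ((x - y) $ i) =
      gauss1 \<epsilon> ((z - y) $ i) * gauss1 (\<epsilon> / 4) (((1 / 2) *s (z + y) - x) $ i)" for i
    using gauss1_mult[OF assms, of "z $ i" "x $ i" "y $ i"] by (simp add: add_divide_distrib)
  then show ?thesis
    using assms by (simp only: gauss_eq_prod prod.distrib[symmetric] half_gt_zero zero_less_divide_iff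
        zero_less_numeral simp_thms)
qed

text \<open>
  Since \<open>Re (z\<^sup>2) = (Re z)\<^sup>2 - (Im z)\<^sup>2\<close>, the modulus is a real Gaussian in the real parts, inflated by a
  factor that depends on the imaginary parts alone. This factor is the source of the exponential
  constant in the final estimate.
\<close>

lemma norm_gauss:
  fixes z :: "complex ^ 'n"
  assumes "\<eta> > 0"
  shows "norm (gauss \<eta> z) = exp ((\<Sum>i\<in>UNIV. (Im (z $ i))\<^sup>2) / (2 * \<eta>)) *
    Re (gauss \<eta> (cvec (\<chi> i. Re (z $ i))))"
proof -
  have "Re (gauss \<eta> (cvec (\<chi> i. Re (z $ i)))) =
      (2 * pi * \<eta>) powr (- real CARD('n) / 2) * exp (- (\<Sum>i\<in>UNIV. (Re (z $ i))\<^sup>2) / (2 * \<eta>))"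
    by (simp add: gauss_cvec norm_vec_def L2_set_def sum_nonneg del: cvec_nth)
  moreover have "norm (gauss \<eta> z) =
      (2 * pi * \<eta>) powr (- real CARD('n) / 2) * exp (Re (- (\<Sum>i\<in>UNIV. (z $ i)\<^sup>2) / of_real (2 * \<eta>)))"
    by (simp add: gauss_def norm_mult)
  moreover have "Re (- (\<Sum>i\<in>UNIV. (z $ i)\<^sup>2) / of_real (2 * \<eta>)) =
      (\<Sum>i\<in>UNIV. (Im (z $ i))\<^sup>2) / (2 * \<eta>) + - (\<Sum>i\<in>UNIV. (Re (z $ i))\<^sup>2) / (2 * \<eta>)"
    unfolding Re_divide_of_real
    by (simp add: sum_subtractf diff_divide_distrib power2_eq_square)
  ultimately show ?thesis by (simp only: exp_add mult_ac)
qed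

lemma norm_gauss1:
  "norm (gauss1 \<eta> w) = (2 * pi * \<eta>) powr (- 1 / 2) * exp (((Im w)\<^sup>2 - (Re w)\<^sup>2) / (2 * \<eta>))"
proof -
  have "Re (- w\<^sup>2 / of_real (2 * \<eta>)) = ((Im w)\<^sup>2 - (Re w)\<^sup>2) / (2 * \<eta>)"
    unfolding Re_divide_of_real by (simp add: power2_eq_square)
  then show ?thesis by (simp add: gauss1_def norm_mult)
qed

text \<open>
  A bound with the translation \<open>a\<close> split off, from \<open>a\<^sup>2 / 2 \<le> (Re w + a)\<^sup>2 + (Re w)\<^sup>2\<close>. It makes
  lattice sums of Gaussians converge uniformly for \<open>w\<close> in a bounded set.
\<close>

lemma norm_gauss1_translate_le:
  assumes "\<eta> > 0"
  shows "norm (gauss1 \<eta> (w + of_real a)) \<le>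
    (2 * pi * \<eta>) powr (- 1 / 2) * exp ((norm w)\<^sup>2 / (2 * \<eta>)) * exp (- a\<^sup>2 / (4 * \<eta>))"
proof -
  have "(Im w)\<^sup>2 - (Re w + a)\<^sup>2 \<le> (norm w)\<^sup>2 - a\<^sup>2 / 2"
    unfolding cmod_power2 using zero_le_power2[of "2 * Re w + a"]
    by (simp add: power2_eq_square algebra_simps)
  then have "((Im w)\<^sup>2 - (Re w + a)\<^sup>2) / (2 * \<eta>) \<le> ((norm w)\<^sup>2 - a\<^sup>2 / 2) / (2 * \<eta>)"
    using assms by (intro divide_right_mono) auto
  also have "\<dots> = (norm w)\<^sup>2 / (2 * \<eta>) + - a\<^sup>2 / (4 * \<eta>)"
    by (simp add: diff_divide_distrib)
  finally have "((Im w)\<^sup>2 - (Re w + a)\<^sup>2) / (2 * \<eta>) \<le> (norm w)\<^sup>2 / (2 * \<eta>) + - a\<^sup>2 / (4 * \<eta>)" .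
  then show ?thesis
    by (simp add: norm_gauss1 mult.assoc exp_add[symmetric] mult_left_mono)
qed

section \<open>Gaussian integrals over complex translates of real space\<close>

text \<open>
  Instead of a contour shift, the characteristic function of the normal distribution is used: after
  translating by \<open>Re w\<close> and rescaling, the imaginary part of \<open>w\<close> contributes exactly the oscillating
  factor \<open>exp(i t x)\<close> with \<open>t = Im w / \<surd>\<eta>\<close> and the constant \<open>exp(t\<^sup>2 / 2)\<close>, and the two cancel.
\<close>

lemma has_bochner_integral_gauss1:
  assumes "\<eta> > 0"
  shows "has_bochner_integral lborel (\<lambda>x. gauss1 \<eta> (w - of_real x)) 1"
proof -
  define t where "t = Im w / sqrt \<eta>"
  define s where "s = sqrt \<eta>"
  have s: "s > 0" "s\<^sup>2 = \<eta>" using assms by (auto simp: s_def)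
  have std: "has_bochner_integral lborel (\<lambda>x. std_normal_density x *\<^sub>R iexp (t * x))
      (of_real (exp (- t\<^sup>2 / 2)))"
  proof -
    have "integrable std_normal_distribution (\<lambda>x. iexp (t * x))"
      by (rule finite_measure.integrable_const_bound[where B=1])
         (auto simp: prob_space_normal_density prob_space.finite_measure)
    moreover have "(LINT x|std_normal_distribution. iexp (t * x)) = of_real (exp (- t\<^sup>2 / 2))"
      using char_std_normal_distribution by (simp add: char_def fun_eq_iff)
    ultimately show ?thesis
      by (simp add: integrable_density integral_density has_bochner_integral_iff normal_density_nonneg)
  qed
  have eq: "s *\<^sub>R gauss1 \<eta> (w - of_real (Re w + s * x)) =
      of_real (exp (t\<^sup>2 / 2)) * (std_normal_density x *\<^sub>R iexp (t * x))" for x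
  proof -
    have ww: "w - of_real (Re w + s * x) = \<i> * of_real (Im w) - of_real (s * x)"
      by (simp add: complex_eq_iff)
    have e: "- (\<i> * of_real (Im w) - of_real (s * x))\<^sup>2 / of_real (2 * \<eta>) =
        of_real (t\<^sup>2 / 2) + of_real (- x\<^sup>2 / 2) + \<i> * of_real (t * x)"
    proof -
      have "Im w = s * t" using s by (simp add: t_def s_def)
      then show ?thesis
        using s by (simp add: s(2)[symmetric] field_simps power2_eq_square)
    qed
    have c: "s * (2 * pi * \<eta>) powr (- 1 / 2) = 1 / sqrt (2 * pi)"
      using assms by (simp add: s_def powr_minus powr_half_sqrt divide_simps real_sqrt_mult)
    have "s *\<^sub>R gauss1 \<eta> (w - of_real (Re w + s * x)) =
        of_real (s * (2 * pi * \<eta>) powr (- 1 / 2)) *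
          exp (of_real (t\<^sup>2 / 2) + of_real (- x\<^sup>2 / 2) + \<i> * of_real (t * x))"
      unfolding gauss1_def ww e by (simp add: scaleR_conv_of_real)
    also have "\<dots> = of_real (exp (t\<^sup>2 / 2)) * (std_normal_density x *\<^sub>R iexp (t * x))"
      unfolding c exp_add exp_of_real std_normal_density_def
      by (simp add: scaleR_conv_of_real)
    finally show ?thesis .
  qed
  have "has_bochner_integral lborel (\<lambda>x. s *\<^sub>R gauss1 \<eta> (w - of_real (Re w + s * x)))
      (of_real (exp (t\<^sup>2 / 2)) * of_real (exp (- t\<^sup>2 / 2)))"
    unfolding eq by (intro has_bochner_integral_mult_right std)
  then have *: "has_bochner_integral lborel (\<lambda>x. s *\<^sub>R gauss1 \<eta> (w - of_real (Re w + s * x))) 1"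
    by (simp add: of_real_mult[symmetric] exp_add[symmetric] del: of_real_mult)
  from has_bochner_integral_scaleR_right[OF *, of "1 / s"]
  have "has_bochner_integral lborel (\<lambda>x. gauss1 \<eta> (w - of_real (Re w + s * x))) (1 /\<^sub>R s)"
    using s by (simp add: divide_inverse)
  then show ?thesis
    using s lborel_has_bochner_integral_real_affine_iff[of s "\<lambda>x. gauss1 \<eta> (w - of_real x)" 1 "Re w"]
    by (simp add: divide_inverse)
qed

text \<open>
  Lebesgue measure on \<open>real ^ 'n\<close> is built as a product indexed by the standard basis vectors, so the index
  \<open>i\<close> has to be identified with the basis vector \<open>axis i 1\<close>.
\<close>

lemma has_bochner_integral_vec_prod:
  fixes f :: "'n::finite \<Rightarrow> real \<Rightarrow> complex"
  assumes "\<And>i. has_bochner_integral lborel (f i) (c i)"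
  shows "has_bochner_integral lborel (\<lambda>x :: real ^ 'n. \<Prod>i\<in>UNIV. f i (x $ i)) (\<Prod>i\<in>UNIV. c i)"
proof -
  interpret product_sigma_finite "\<lambda>_::real ^ 'n. lborel :: real measure" ..
  let ?ax = "\<lambda>i::'n. axis i (1::real)"
  let ?P = "\<Pi>\<^sub>M b\<in>(Basis::(real^'n) set). (lborel::real measure)"
  have inj: "inj ?ax" by (auto simp: inj_on_def axis_eq_axis)
  have bas: "(Basis::(real^'n) set) = range ?ax" by (auto simp: Basis_vec_def)
  define F where "F b = f (inv ?ax b)" for b
  have F: "F (?ax i) = f i" for i unfolding F_def by (simp only: inv_f_f[OF inj])
  have f: "integrable lborel (f i)" "integral\<^sup>L lborel (f i) = c i" for i
    using assms[of i] by (auto simp: has_bochner_integral_iff)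
  have [measurable]: "f i \<in> borel_measurable borel" for i
    using f(1)[of i] by (simp add: borel_measurable_integrable[simplified])
  have prod: "(\<Prod>b\<in>Basis. F b (g b)) = (\<Prod>i\<in>UNIV. f i (g (?ax i)))" for g
    unfolding bas using inj by (subst prod.reindex) (auto simp: F)
  have comp: "(\<Sum>b\<in>Basis. g b *\<^sub>R b) $ i = g (?ax i)" for g :: "real^'n \<Rightarrow> real" and i
  proof -
    have "(\<Sum>b\<in>Basis. g b *\<^sub>R b) $ i = (\<Sum>j\<in>UNIV. g (?ax j) * (?ax j $ i))"
      unfolding bas using inj by (subst sum.reindex) auto
    also have "\<dots> = (\<Sum>j\<in>UNIV. if j = i then g (?ax i) else 0)"
      by (intro sum.cong) (auto simp: axis_def)
    finally show ?thesis by simp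
  qed
  have "integrable ?P (\<lambda>g. \<Prod>b\<in>Basis. F b (g b))"
    by (rule product_integrable_prod) (auto simp: F_def f)
  moreover have "(\<integral>g. (\<Prod>b\<in>Basis. F b (g b)) \<partial>?P) = (\<Prod>b\<in>Basis. integral\<^sup>L lborel (F b))"
    by (rule product_integral_prod) (auto simp: F_def f)
  moreover have "(\<Prod>b\<in>(Basis::(real^'n) set). integral\<^sup>L lborel (F b)) = (\<Prod>i\<in>UNIV. c i)"
    unfolding bas using inj by (subst prod.reindex) (auto simp: F f)
  ultimately have P: "has_bochner_integral ?P (\<lambda>g. \<Prod>i\<in>UNIV. f i (g (?ax i))) (\<Prod>i\<in>UNIV. c i)"
    by (simp add: has_bochner_integral_iff prod)
  have T: "(\<lambda>g. \<Sum>b\<in>Basis. g b *\<^sub>R b) \<in> measurable ?P (borel :: (real^'n) measure)"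
    by measurable
  have m: "(\<lambda>x::real^'n. \<Prod>i\<in>UNIV. f i (x $ i)) \<in> borel_measurable borel"
    by measurable
  show ?thesis
    unfolding has_bochner_integral_iff
    using P unfolding has_bochner_integral_iff
    by (subst (1 2) lborel_eq)
       (simp add: integrable_distr_eq[OF T m] integral_distr[OF T m] comp del: sum_component)
qed

lemma has_bochner_integral_gauss:
  fixes z :: "complex ^ 'n"
  assumes "\<eta> > 0"
  shows "has_bochner_integral lborel (\<lambda>x :: real ^ 'n. gauss \<eta> (z - cvec x)) 1"
  using has_bochner_integral_vec_prod[of "\<lambda>i x. gauss1 \<eta> (z $ i - of_real x)" "\<lambda>_. 1"]
    has_bochner_integral_gauss1[OF assms]
  by (simp add: gauss_eq_prod[OF assms])

lemma has_bochner_integral_norm_gauss: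
  fixes z :: "complex ^ 'n"
  assumes "\<eta> > 0"
  shows "has_bochner_integral lborel (\<lambda>x :: real ^ 'n. norm (gauss \<eta> (z - cvec x)))
    (exp ((\<Sum>i\<in>UNIV. (Im (z $ i))\<^sup>2) / (2 * \<eta>)))"
proof -
  let ?e = "exp ((\<Sum>i\<in>UNIV. (Im (z $ i))\<^sup>2) / (2 * \<eta>))"
  let ?r = "\<chi> i. Re (z $ i)"
  have eq: "norm (gauss \<eta> (z - cvec x)) = ?e * Re (gauss \<eta> (cvec ?r - cvec x))" for x :: "real ^ 'n"
  proof -
    have "cvec (\<chi> i. Re ((z - cvec x) $ i)) = cvec ?r - cvec x" by (simp add: vec_eq_iff)
    then show ?thesis unfolding norm_gauss[OF assms] by simp
  qed
  show ?thesis
    unfolding eq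
    using has_bochner_integral_mult_right[OF has_bochner_integral_bounded_linear[OF bounded_linear_Re
        has_bochner_integral_gauss[OF assms, of "cvec ?r"]], of ?e]
    by simp
qed

lemma integrable_gauss_mult_bounded:
  fixes h :: "real ^ 'n \<Rightarrow> complex" and z :: "complex ^ 'n"
  assumes "\<eta> > 0" "h \<in> borel_measurable borel" "\<And>x. norm (h x) \<le> B"
  shows "integrable lborel (\<lambda>x. gauss \<eta> (z - cvec x) * h x)"
proof (rule Bochner_Integration.integrable_bound)
  have int: "integrable lborel (\<lambda>x :: real ^ 'n. gauss \<eta> (z - cvec x))"
    using has_bochner_integral_gauss[OF assms(1), of z] by (simp add: has_bochner_integral_iff)
  show "(\<lambda>x. gauss \<eta> (z - cvec x) * h x) \<in> borel_measurable lborel"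
    using borel_measurable_integrable[OF int] assms(2) by simp
  show "integrable lborel (\<lambda>x :: real ^ 'n. gauss \<eta> (z - cvec x) * of_real B)"
    using int by simp
  show "AE x in lborel. norm (gauss \<eta> (z - cvec x) * h x) \<le> norm (gauss \<eta> (z - cvec x) * of_real B)"
    by (intro AE_I2) (auto simp: norm_mult intro!: mult_left_mono order_trans[OF assms(3)])
qed

text \<open>
  Smoothing does not increase the supremum on the real space; moving off the real space costs just the
  factor from the imaginary part.
\<close>

lemma norm_gauss_smoothing_le:
  fixes h :: "real ^ 'n \<Rightarrow> complex" and z :: "complex ^ 'n"
  assumes "\<eta> > 0" "h \<in> borel_measurable borel" "\<And>x. norm (h x) \<le> B"
  shows "norm (LINT x|lborel. gauss \<eta> (z - cvec x) * h x) \<le>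
    exp ((\<Sum>i\<in>UNIV. (Im (z $ i))\<^sup>2) / (2 * \<eta>)) * B"
proof -
  have n: "has_bochner_integral lborel (\<lambda>x :: real ^ 'n. norm (gauss \<eta> (z - cvec x)) * B)
      (exp ((\<Sum>i\<in>UNIV. (Im (z $ i))\<^sup>2) / (2 * \<eta>)) * B)"
    by (intro has_bochner_integral_mult_left has_bochner_integral_norm_gauss assms)
  have "norm (LINT x|lborel. gauss \<eta> (z - cvec x) * h x) \<le>
      (LINT x|lborel. norm (gauss \<eta> (z - cvec x)) * B)"
  proof (rule Bochner_Integration.integral_norm_bound_integral)
    show "norm (gauss \<eta> (z - cvec x) * h x) \<le> norm (gauss \<eta> (z - cvec x)) * B" for x
      unfolding norm_mult by (intro mult_left_mono assms) auto
    show "integrable lborel (\<lambda>x :: real ^ 'n. norm (gauss \<eta> (z - cvec x)) * B)"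
      using n unfolding has_bochner_integral_iff by blast
  qed (rule integrable_gauss_mult_bounded[OF assms])
  then show ?thesis unfolding has_bochner_integral_integral_eq[OF n] .
qed

section \<open>The periodised Gaussian\<close>

lemma period_nth [simp]: "period L k $ i = of_real (L * of_int (k $ i))"
  by (simp add: period_def)

lemma period_add: "period L (j + k) = period L j + period L k"
  by (simp add: vec_eq_iff algebra_simps)

lemma cvec_period: "cvec (period L k) = period L k"
  by (simp add: vec_eq_iff)

lemma summable_on_int_exp_square:
  assumes "c > 0"
  shows "(\<lambda>k::int. exp (- c * (of_int k)\<^sup>2) :: real) summable_on UNIV"
proof -
  let ?f = "\<lambda>k::int. exp (- c * (of_int k)\<^sup>2) :: real"
  have nat: "(\<lambda>n::nat. exp (- c * (of_nat n)\<^sup>2) :: real) summable_on UNIV"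
  proof (rule norm_summable_imp_summable_on, rule summable_comparison_test)
    show "summable (\<lambda>n. exp (- c) ^ n)"
      using assms by (intro summable_geometric) simp
    have "exp (- c * (of_nat n)\<^sup>2) \<le> exp (- c) ^ n" for n :: nat
    proof -
      have "real n \<le> (real n)\<^sup>2" by (cases n) (auto simp: power2_eq_square)
      then have "- c * (of_nat n)\<^sup>2 \<le> of_nat n * (- c)" using assms by (simp add: mult.commute)
      then show ?thesis by (simp only: exp_of_nat_mult[symmetric] exp_le_cancel_iff)
    qed
    then show "\<exists>N. \<forall>n\<ge>N. norm (norm (exp (- c * (of_nat n)\<^sup>2))) \<le> exp (- c) ^ n"
      by auto
  qed
  have "?f summable_on range int"
    using nat by (subst summable_on_reindex) (auto simp: o_def)
  moreover have "?f summable_on range (\<lambda>n. - int n)"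
    using nat by (subst summable_on_reindex) (auto simp: o_def inj_on_def)
  \<comment> \<open>0 belongs to both ranges, so it is removed from the second one\<close>
  then have "?f summable_on (range (\<lambda>n. - int n) - range int)"
    by (rule summable_on_subset_banach) auto
  ultimately have "?f summable_on (range int \<union> (range (\<lambda>n. - int n) - range int))"
    by (intro summable_on_Un_disjoint) auto
  moreover have "k \<in> range int \<union> range (\<lambda>n. - int n)" for k
    by (cases k rule: int_cases2) auto
  then have "range int \<union> (range (\<lambda>n. - int n) - range int) = UNIV"
    by blast
  ultimately show ?thesis by simp
qed

lemma summable_on_vec_prod:
  fixes f :: "'b::countable \<Rightarrow> real"
  assumes "f summable_on UNIV" "\<And>k. f k \<ge> 0"
  shows "(\<lambda>k :: 'b ^ 'n. \<Prod>i\<in>UNIV. f (k $ i)) summable_on UNIV"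
proof -
  have "(\<lambda>k. norm (f k)) summable_on UNIV" using assms by simp
  then have "Infinite_Set_Sum.abs_summable_on f UNIV" by (simp only: abs_summable_equivalent)
  then have "Infinite_Set_Sum.abs_summable_on (\<lambda>g. \<Prod>i\<in>(UNIV::'n set). f (g i)) (Pi\<^sub>E UNIV (\<lambda>_. UNIV))"
    by (intro abs_summable_on_prod_PiE) auto
  then have "(\<lambda>g. norm (\<Prod>i\<in>(UNIV::'n set). f (g i))) summable_on UNIV"
    by (simp only: abs_summable_equivalent[symmetric] PiE_UNIV_domain Pi_UNIV)
  then have "(\<lambda>g. \<Prod>i\<in>(UNIV::'n set). f (g i)) summable_on UNIV"
    by (rule abs_summable_summable)
  moreover have "bij_betw (\<lambda>k :: 'b ^ 'n. vec_nth k) UNIV UNIV"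
    by (rule bij_betwI[where g=vec_lambda]) auto
  ultimately show ?thesis
    by (simp add: summable_on_reindex_bij_betw[of vec_nth UNIV UNIV "\<lambda>g. \<Prod>i\<in>(UNIV::'n set). f (g i)"])
qed

text \<open>
  A summable majorant that is uniform for \<open>w\<close> in a ball. The Gaussian factorises over the coordinates, which
  reduces summability over the lattice to that of \<open>exp(- c k\<^sup>2)\<close> over the integers.
\<close>

lemma gauss_lattice_majorant:
  fixes R :: real
  assumes "\<eta> > 0" "L > 0"
  obtains m :: "int ^ 'n \<Rightarrow> real" where "m summable_on UNIV"
    "\<And>w k. norm w \<le> R \<Longrightarrow> norm (gauss \<eta> (w + period L k)) \<le> m k"
proof
  let ?A = "(2 * pi * \<eta>) powr (- 1 / 2) * exp (R\<^sup>2 / (2 * \<eta>))"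
  let ?m = "\<lambda>k::int. ?A * exp (- (L\<^sup>2 / (4 * \<eta>)) * (of_int k)\<^sup>2)"
  show "(\<lambda>k :: int ^ 'n. \<Prod>i\<in>UNIV. ?m (k $ i)) summable_on UNIV"
    by (intro summable_on_vec_prod summable_on_cmult_right summable_on_int_exp_square)
      (use assms in auto)
  fix w :: "complex ^ 'n" and k :: "int ^ 'n"
  assume w: "norm w \<le> R"
  have n: "norm (gauss1 \<eta> ((w + period L k) $ i)) \<le> ?m (k $ i)" for i
  proof -
    have "norm (w $ i) \<le> R" using Finite_Cartesian_Product.norm_nth_le[of w i] w by linarith
    then have "exp ((norm (w $ i))\<^sup>2 / (2 * \<eta>)) \<le> exp (R\<^sup>2 / (2 * \<eta>))"
      using assms by (simp add: divide_right_mono power_mono)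
    then have "(2 * pi * \<eta>) powr (- 1 / 2) * exp ((norm (w $ i))\<^sup>2 / (2 * \<eta>)) *
        exp (- (L * of_int (k $ i))\<^sup>2 / (4 * \<eta>)) \<le> ?A * exp (- (L * of_int (k $ i))\<^sup>2 / (4 * \<eta>))"
      by (intro mult_right_mono mult_left_mono) auto
    with norm_gauss1_translate_le[OF assms(1), of "w $ i" "L * of_int (k $ i)"]
    show ?thesis by (simp add: power_mult_distrib)
  qed
  show "norm (gauss \<eta> (w + period L k)) \<le> (\<Prod>i\<in>UNIV. ?m (k $ i))"
    unfolding gauss_eq_prod[OF assms(1)] prod_norm[symmetric]
    by (intro prod_mono conjI norm_ge_zero n)
qed

lemma gauss_lattice_abs_summable:
  fixes z :: "complex ^ 'n"
  assumes "\<eta> > 0" "L > 0"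
  shows "(\<lambda>k. norm (gauss \<eta> (z + period L k))) summable_on UNIV"
proof -
  obtain m :: "int ^ 'n \<Rightarrow> real" where m: "m summable_on UNIV"
    "\<And>w k. norm w \<le> norm z \<Longrightarrow> norm (gauss \<eta> (w + period L k)) \<le> m k"
    using gauss_lattice_majorant[OF assms] by metis
  show ?thesis by (rule summable_on_comparison_test[OF m(1)]) (auto intro: m(2))
qed

lemma continuous_on_gauss_per:
  assumes "\<eta> > 0" "L > 0"
  shows "continuous_on UNIV (gauss_per \<eta> L :: complex ^ 'n \<Rightarrow> complex)"
proof -
  have "continuous_on (ball 0 R) (gauss_per \<eta> L :: complex ^ 'n \<Rightarrow> complex)" for R
  proof -
    obtain m :: "int ^ 'n \<Rightarrow> real" where m: "m summable_on UNIV"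
      "\<And>w k. norm w \<le> R \<Longrightarrow> norm (gauss \<eta> (w + period L k)) \<le> m k"
      using gauss_lattice_majorant[OF assms] by metis
    have "uniform_limit (ball 0 R) (\<lambda>F z. \<Sum>k\<in>F. gauss \<eta> (z + period L k))
        (gauss_per \<eta> L :: complex ^ 'n \<Rightarrow> complex) (finite_subsets_at_top UNIV)"
      unfolding gauss_per_def by (rule Weierstrass_m_test_general[OF _ m(1)]) (auto intro: m(2))
    then show ?thesis
      by (rule uniform_limit_theorem[rotated])
        (use assms in \<open>auto intro!: always_eventually continuous_intros\<close>)
  qed
  then have "continuous_on (\<Union>R. ball 0 R) (gauss_per \<eta> L :: complex ^ 'n \<Rightarrow> complex)"
    by (intro continuous_on_open_UN) auto
  moreover have "(\<Union>R. ball (0 :: complex ^ 'n) R) = UNIV"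
    by (auto intro: gt_ex)
  ultimately show ?thesis by simp
qed

lemma gauss_per_periodic: "gauss_per \<eta> L (z + period L j) = gauss_per \<eta> L z"
proof -
  have "bij_betw (\<lambda>k. j + k) UNIV UNIV" by (rule bij_betwI[where g="\<lambda>k. k - j"]) auto
  from infsum_reindex_bij_betw[OF this, of "\<lambda>k. gauss \<eta> (z + period L k)"]
  show ?thesis by (simp add: gauss_per_def period_add add.assoc)
qed

text \<open>
  Every point is translated into the compact fundamental cube by rounding its coordinates down to
  multiples of \<open>L\<close>.
\<close>

lemma bounded_periodic:
  fixes f :: "real ^ 'n \<Rightarrow> complex"
  assumes "L > 0" "periodic_on L UNIV f" "continuous_on UNIV f"
  obtains B where "\<And>x. norm (f x) \<le> B"
proof -
  have "bounded (f ` fund_cube L)"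
    unfolding fund_cube_def
    by (intro compact_imp_bounded compact_continuous_image continuous_on_subset[OF assms(3)]) auto
  then obtain B where B: "\<And>x. x \<in> fund_cube L \<Longrightarrow> norm (f x) \<le> B"
    by (auto simp: bounded_iff)
  have "norm (f x) \<le> B" for x
  proof -
    define k :: "int ^ 'n" where "k = (\<chi> i. - \<lfloor>x $ i / L\<rfloor>)"
    have "0 \<le> x $ i + L * of_int (k $ i) \<and> x $ i + L * of_int (k $ i) \<le> L" for i
    proof -
      have "L * of_int \<lfloor>x $ i / L\<rfloor> \<le> L * (x $ i / L)"
        using assms(1) by (intro mult_left_mono of_int_floor_le) auto
      moreover have "L * (x $ i / L) \<le> L * (of_int \<lfloor>x $ i / L\<rfloor> + 1)"
        using assms(1) by (intro mult_left_mono real_of_int_floor_add_one_ge) auto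
      ultimately have "L * of_int \<lfloor>x $ i / L\<rfloor> \<le> x $ i" "x $ i \<le> L * (of_int \<lfloor>x $ i / L\<rfloor> + 1)"
        using assms(1) by auto
      then show ?thesis by (simp add: k_def algebra_simps)
    qed
    then have "x + period L k \<in> fund_cube L"
      by (simp add: fund_cube_def mem_box_cart)
    then show ?thesis using B assms(2) by (metis periodic_on_def UNIV_I)
  qed
  then show ?thesis using that by blast
qed

lemma gauss_per_cvec:
  assumes "\<eta> > 0" "L > 0"
  shows borel_measurable_gauss_per_cvec:
      "(\<lambda>x :: real ^ 'n. gauss_per \<eta> L (cvec x)) \<in> borel_measurable borel"
    and bounded_gauss_per_cvec: "\<exists>B. \<forall>x :: real ^ 'n. norm (gauss_per \<eta> L (cvec x)) \<le> B"
proof -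
  have c: "continuous_on UNIV (\<lambda>x :: real ^ 'n. gauss_per \<eta> L (cvec x))"
    by (rule continuous_on_compose2[OF continuous_on_gauss_per[OF assms]]) (auto intro!: continuous_intros)
  then show "(\<lambda>x :: real ^ 'n. gauss_per \<eta> L (cvec x)) \<in> borel_measurable borel"
    by (rule borel_measurable_continuous_onI)
  have "periodic_on L UNIV (\<lambda>x :: real ^ 'n. gauss_per \<eta> L (cvec x))"
    by (simp add: periodic_on_def cvec_add cvec_period gauss_per_periodic)
  from bounded_periodic[OF assms(2) this c]
  show "\<exists>B. \<forall>x :: real ^ 'n. norm (gauss_per \<eta> L (cvec x)) \<le> B" by metis
qed

text \<open>
  The semigroup property for the periodised kernel. Only one of the two factors on the right is
  periodised, as the integral runs over the whole space and not over the torus. The sum over the lattice is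
  treated as an integral for counting measure, so that Fubini applies: by the product formula, the integral
  of the modulus of the \<open>k\<close>-th term is the modulus of \<open>gauss \<epsilon>\<close> at the translated point times
  a factor that depends on \<open>Im z\<close> only.
\<close>

lemma gauss_per_convolution:
  fixes z :: "complex ^ 'n" and y :: "real ^ 'n"
  assumes "\<epsilon> > 0" "L > 0"
  shows "gauss_per \<epsilon> L (z - cvec y) =
    (LINT x|lborel. gauss (\<epsilon> / 2) (z - cvec x) * gauss_per (\<epsilon> / 2) L (cvec x - cvec y))"
proof -
  interpret pair_sigma_finite "count_space (UNIV :: (int ^ 'n) set)" "lborel :: (real ^ 'n) measure"
    by (intro pair_sigma_finite.intro sigma_finite_measure_count_space sigma_finite_lborel)
  let ?f = "\<lambda>(k :: int ^ 'n) (x :: real ^ 'n).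
    gauss (\<epsilon> / 2) (z - cvec x) * gauss (\<epsilon> / 2) (cvec x - cvec y + period L k)"
  let ?m = "\<lambda>k :: int ^ 'n. (1 / 2) *s (z + (cvec y - period L k))"
  let ?E = "exp ((\<Sum>i\<in>UNIV. (Im (z $ i) / 2)\<^sup>2) / (2 * (\<epsilon> / 4)))"
  have e: "\<epsilon> / 2 > 0" "\<epsilon> / 4 > 0" using assms by auto
  have f: "?f k x = gauss \<epsilon> (z - cvec y + period L k) * gauss (\<epsilon> / 4) (?m k - cvec x)" for k x
    using gauss_mult[OF assms(1), of z "cvec x" "cvec y - period L k"] by (simp add: algebra_simps)
  have int_f: "has_bochner_integral lborel (?f k) (gauss \<epsilon> (z - cvec y + period L k))" for k
    using has_bochner_integral_mult_right[OF has_bochner_integral_gauss[OF e(2), of "?m k"],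
        of "gauss \<epsilon> (z - cvec y + period L k)"]
    unfolding f by simp
  have "has_bochner_integral lborel (\<lambda>x. norm (gauss \<epsilon> (z - cvec y + period L k)) *
      norm (gauss (\<epsilon> / 4) (?m k - cvec x)))
      (norm (gauss \<epsilon> (z - cvec y + period L k)) * exp ((\<Sum>i\<in>UNIV. (Im (?m k $ i))\<^sup>2) / (2 * (\<epsilon> / 4))))" for k
    by (intro has_bochner_integral_mult_right has_bochner_integral_norm_gauss e)
  then have norm_f: "has_bochner_integral lborel (\<lambda>x. norm (?f k x))
      (norm (gauss \<epsilon> (z - cvec y + period L k)) * ?E)" for k
    unfolding f norm_mult by simp
  have "integrable (count_space UNIV \<Otimes>\<^sub>M lborel) (case_prod ?f)"
  proof (rule Fubini_integrable)
    show "case_prod ?f \<in> borel_measurable (count_space UNIV \<Otimes>\<^sub>M lborel)"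
      by (rule measurable_pair_measure_countable1)
        (use borel_measurable_has_bochner_integral[OF int_f] in auto)
    have "(\<lambda>k. norm (gauss \<epsilon> (z - cvec y + period L k)) * ?E) summable_on UNIV"
      by (intro summable_on_cmult_left gauss_lattice_abs_summable assms)
    then have "(\<lambda>k. norm (norm (gauss \<epsilon> (z - cvec y + period L k)) * ?E)) summable_on UNIV"
      by simp
    then have "integrable (count_space UNIV) (\<lambda>k. norm (gauss \<epsilon> (z - cvec y + period L k)) * ?E)"
      by (simp only: abs_summable_equivalent abs_summable_on_def)
    then show "integrable (count_space UNIV) (\<lambda>k. \<integral>x. norm (case_prod ?f (k, x)) \<partial>lborel)"
      using norm_f by (simp add: has_bochner_integral_iff)
    show "AE k in count_space UNIV. integrable lborel (\<lambda>x. case_prod ?f (k, x))"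
      using int_f by (simp add: has_bochner_integral_iff)
  qed
  from Fubini_integral[OF this]
  have "(\<integral>k. gauss \<epsilon> (z - cvec y + period L k) \<partial>count_space UNIV) =
      (LINT x|lborel. gauss (\<epsilon> / 2) (z - cvec x) *
        (\<integral>k. gauss (\<epsilon> / 2) (cvec x - cvec y + period L k) \<partial>count_space UNIV))"
    using int_f by (simp add: has_bochner_integral_iff)
  moreover have "(\<integral>k. gauss \<eta> (w + period L k) \<partial>count_space UNIV) = gauss_per \<eta> L w"
    if "\<eta> > 0" for \<eta> and w :: "complex ^ 'n"
    using infsetsum_infsum[of "\<lambda>k. gauss \<eta> (w + period L k)" UNIV]
      gauss_lattice_abs_summable[OF that assms(2), of w]
    by (simp only: abs_summable_equivalent infsetsum_def gauss_per_def)
  ultimately show ?thesis using assms(1) e by simp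
qed

section \<open>The operators at one scale as smoothings of the operators at half the scale\<close>

lemma torus_density_integrable:
  assumes "torus_density L \<rho>"
  shows "integrable lborel (\<lambda>y. indicator (fund_cube L) y * \<rho> y)"
  using assms not_integrable_integral_eq[of lborel "\<lambda>y. indicator (fund_cube L) y * \<rho> y"]
  by (auto simp: torus_density_def set_lebesgue_integral_def)

text \<open>
  The density of the (complex) measure against which the kernel is integrated. The indicator turns an integral over the
  cube into one over the whole space.
\<close>

definition weight :: "real \<Rightarrow> (real ^ 'n \<Rightarrow> real) \<Rightarrow> (complex ^ 'n \<Rightarrow> complex) \<Rightarrow> real ^ 'n \<Rightarrow> complex" where
  "weight L \<rho> \<phi> y = \<phi> (cvec y) * of_real (indicator (fund_cube L) y * \<rho> y)"

lemma kernel_op_eq: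
  "kernel_op L \<rho> \<epsilon> \<phi> z = (LINT y|lborel. gauss_per \<epsilon> L (z - cvec y) * weight L \<rho> \<phi> y)"
  unfolding kernel_op_def set_lebesgue_integral_def weight_def
  by (intro Bochner_Integration.integral_cong) (auto simp: indicator_def)

text \<open>
  The total mass of the weight is controlled by the supremum of \<open>\<phi>\<close> on the real points alone.
\<close>

lemma weight_bounds:
  assumes "torus_density L \<rho>" "continuous_on UNIV (\<lambda>y. \<phi> (cvec y))"
    and B: "\<And>y. norm (\<phi> (cvec y)) \<le> B"
  shows integrable_weight: "integrable lborel (weight L \<rho> \<phi>)"
    and integral_norm_weight_le: "(LINT y|lborel. norm (weight L \<rho> \<phi> y)) \<le>
      B * (LINT y|lborel. norm (indicator (fund_cube L) y * \<rho> y))"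
proof -
  note i = torus_density_integrable[OF assms(1)]
  have [measurable]: "(\<lambda>y. \<phi> (cvec y)) \<in> borel_measurable borel"
    using assms(2) by (rule borel_measurable_continuous_onI)
  have [measurable]: "(\<lambda>y. indicator (fund_cube L) y * \<rho> y) \<in> borel_measurable borel"
    using borel_measurable_integrable[OF i] by simp
  have le: "norm (weight L \<rho> \<phi> y) \<le> B * norm (indicator (fund_cube L) y * \<rho> y)" for y
    using mult_right_mono[OF B[of y], of "norm (indicator (fund_cube L) y * \<rho> y)"]
    by (simp add: weight_def norm_mult abs_mult)
  have j: "integrable lborel (\<lambda>y. B * norm (indicator (fund_cube L) y * \<rho> y))"
    by (intro integrable_mult_right integrable_norm i)
  show k: "integrable lborel (weight L \<rho> \<phi>)"
  proof (rule Bochner_Integration.integrable_bound[OF j])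
    show "weight L \<rho> \<phi> \<in> borel_measurable lborel"
      unfolding weight_def[abs_def] measurable_lborel2 by measurable
    show "AE y in lborel. norm (weight L \<rho> \<phi> y) \<le> norm (B * norm (indicator (fund_cube L) y * \<rho> y))"
      using le by (intro AE_I2) (metis abs_ge_self order_trans real_norm_def)
  qed
  have "(LINT y|lborel. norm (weight L \<rho> \<phi> y)) \<le>
      (LINT y|lborel. B * norm (indicator (fund_cube L) y * \<rho> y))"
    using le by (intro integral_mono integrable_norm k j)
  then show "(LINT y|lborel. norm (weight L \<rho> \<phi> y)) \<le>
      B * (LINT y|lborel. norm (indicator (fund_cube L) y * \<rho> y))" by simp
qed

text \<open>
  The integrand of the double integral is dominated by a multiple of the product of \<open>\<bar>g\<^sub>\<epsilon>\<^sub>/\<^sub>2(z - x)\<bar>\<close> and the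
  weight at \<open>y\<close>, because the periodised Gaussian is bounded on real points; so Fubini applies.
\<close>

lemma kernel_op_smoothing:
  fixes \<phi> :: "complex ^ 'n \<Rightarrow> complex"
  assumes "\<epsilon> > 0" "L > 0" "integrable lborel (weight L \<rho> \<phi>)"
  shows "has_bochner_integral lborel (\<lambda>x. gauss (\<epsilon> / 2) (z - cvec x) * kernel_op L \<rho> (\<epsilon> / 2) \<phi> (cvec x))
    (kernel_op L \<rho> \<epsilon> \<phi> z)"
proof -
  have e: "\<epsilon> / 2 > 0" using assms by simp
  define P where "P x = gauss_per (\<epsilon> / 2) L (cvec x)" for x :: "real ^ 'n"
  have [measurable]: "P \<in> borel_measurable borel"
    unfolding P_def by (rule borel_measurable_gauss_per_cvec[OF e assms(2)])
  obtain B where B: "\<And>x. norm (P x) \<le> B"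
    using bounded_gauss_per_cvec[OF e assms(2)] unfolding P_def by metis
  define g where "g x = gauss (\<epsilon> / 2) (z - cvec x)" for x
  define w where "w = weight L \<rho> \<phi>"
  have ng: "integrable lborel (\<lambda>x. norm (g x))"
    using has_bochner_integral_norm_gauss[OF e, of z] by (simp add: g_def has_bochner_integral_iff)
  have ig: "integrable lborel g"
    using has_bochner_integral_gauss[OF e, of z] by (simp add: g_def[abs_def] has_bochner_integral_iff)
  have iw: "integrable lborel w" using assms(3) by (simp add: w_def)
  have [measurable]: "g \<in> borel_measurable borel" "w \<in> borel_measurable borel"
    using borel_measurable_integrable[OF ig] borel_measurable_integrable[OF iw] by simp_all
  let ?f = "\<lambda>x y. g x * (P (x - y) * w y)"
  have prod: "integrable (lborel \<Otimes>\<^sub>M lborel) (\<lambda>(x, y). g x * (of_real B * w y))"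
  proof (rule lborel_pair.Fubini_integrable)
    show "(\<lambda>(x, y). g x * (of_real B * w y)) \<in> borel_measurable (lborel \<Otimes>\<^sub>M lborel)"
      by measurable
    show "integrable lborel (\<lambda>x. \<integral>y. norm (case (x, y) of (x, y) \<Rightarrow> g x * (of_real B * w y)) \<partial>lborel)"
      using ng by (simp add: norm_mult)
  qed (use iw in auto)
  have int: "integrable (lborel \<Otimes>\<^sub>M lborel) (\<lambda>(x, y). ?f x y)"
  proof (rule Bochner_Integration.integrable_bound[OF prod])
    show "(\<lambda>(x, y). ?f x y) \<in> borel_measurable (lborel \<Otimes>\<^sub>M lborel)" by measurable
    have "norm (P v) \<le> \<bar>B\<bar>" for v using B[of v] by linarith
    then have "norm (?f x y) \<le> norm (g x * (of_real B * w y))" for x y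
      unfolding norm_mult norm_of_real by (intro mult_left_mono mult_right_mono) auto
    then show "AE p in lborel \<Otimes>\<^sub>M lborel. norm (case p of (x, y) \<Rightarrow> ?f x y) \<le>
        norm (case p of (x, y) \<Rightarrow> g x * (of_real B * w y))"
      by (intro AE_I2) auto
  qed
  have k: "(LINT y|lborel. ?f x y) = g x * kernel_op L \<rho> (\<epsilon> / 2) \<phi> (cvec x)" for x
    by (simp add: kernel_op_eq P_def w_def cvec_diff)
  have "(LINT x|lborel. ?f x y) = gauss_per \<epsilon> L (z - cvec y) * w y" for y
    unfolding gauss_per_convolution[OF assms(1,2)]
    by (simp add: g_def P_def cvec_diff mult.assoc[symmetric])
  then have "kernel_op L \<rho> \<epsilon> \<phi> z = (LINT y|lborel. LINT x|lborel. ?f x y)"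
    by (simp add: kernel_op_eq w_def)
  also have "\<dots> = (LINT x|lborel. LINT y|lborel. ?f x y)"
    by (rule lborel_pair.Fubini_integral[OF int])
  finally show ?thesis
    using lborel_pair.integrable_fst[OF int] unfolding k unfolding g_def
    by (simp add: has_bochner_integral_iff)
qed

lemma empirical_op_smoothing:
  fixes \<phi> :: "complex ^ 'n \<Rightarrow> complex"
  assumes "\<epsilon> > 0" "L > 0"
  shows "has_bochner_integral lborel (\<lambda>x. gauss (\<epsilon> / 2) (z - cvec x) * empirical_op L M X (\<epsilon> / 2) \<phi> (cvec x))
    (empirical_op L M X \<epsilon> \<phi> z)"
proof -
  have e: "\<epsilon> / 2 > 0" using assms by simp
  have *: "has_bochner_integral lborel
      (\<lambda>x. gauss (\<epsilon> / 2) (z - cvec x) * gauss_per (\<epsilon> / 2) L (cvec x - cvec y))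
      (gauss_per \<epsilon> L (z - cvec y))" for y :: "real ^ 'n"
  proof -
    obtain B where B: "\<And>x :: real ^ 'n. norm (gauss_per (\<epsilon> / 2) L (cvec x)) \<le> B"
      using bounded_gauss_per_cvec[OF e assms(2)] by metis
    have m: "(\<lambda>x. gauss_per (\<epsilon> / 2) L (cvec (x - y))) \<in> borel_measurable borel"
      by (rule measurable_compose[OF _ borel_measurable_gauss_per_cvec[OF e assms(2)]]) measurable
    have "integrable lborel (\<lambda>x. gauss (\<epsilon> / 2) (z - cvec x) * gauss_per (\<epsilon> / 2) L (cvec (x - y)))"
      by (rule integrable_gauss_mult_bounded[OF e m B])
    then show ?thesis
      using gauss_per_convolution[OF assms, of z y] by (simp add: has_bochner_integral_iff cvec_diff)
  qed
  have "has_bochner_integral lborel (\<lambda>x. (1 / of_nat M) * (\<Sum>i=1..M.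
      gauss (\<epsilon> / 2) (z - cvec x) * gauss_per (\<epsilon> / 2) L (cvec x - cvec (X i)) * \<phi> (cvec (X i))))
      (empirical_op L M X \<epsilon> \<phi> z)"
    unfolding empirical_op_def
    by (intro has_bochner_integral_mult_right has_bochner_integral_sum has_bochner_integral_mult_left *)
  then show ?thesis
    by (simp add: empirical_op_def sum_distrib_left mult_ac)
qed

text \<open>
  The identity behind all parts of the theorem: the operators at scale \<open>\<epsilon>\<close> are recovered, at complex points, from
  the values of the operators at scale \<open>\<epsilon> / 2\<close> at real points.
\<close>

lemma op_diff_smoothing:
  fixes \<phi> :: "complex ^ 'n \<Rightarrow> complex"
  assumes "\<epsilon> > 0" "L > 0" "integrable lborel (weight L \<rho> \<phi>)"
  shows "op_diff L \<rho> M X \<epsilon> \<phi> z =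
    (LINT x|lborel. gauss (\<epsilon> / 2) (z - cvec x) * op_diff L \<rho> M X (\<epsilon> / 2) \<phi> (cvec x))"
  using has_bochner_integral_diff[OF empirical_op_smoothing[OF assms(1,2)] kernel_op_smoothing[OF assms],
      of z M X \<phi> z]
  unfolding op_diff_def right_diff_distrib by (simp add: has_bochner_integral_iff)

lemma op_diff_cvec_measurable:
  fixes \<phi> :: "complex ^ 'n \<Rightarrow> complex"
  assumes "\<eta> > 0" "L > 0" "integrable lborel (weight L \<rho> \<phi>)"
  shows "(\<lambda>x. op_diff L \<rho> M X \<eta> \<phi> (cvec x)) \<in> borel_measurable borel"
proof -
  define P where "P x = gauss_per \<eta> L (cvec x)" for x :: "real ^ 'n"
  have [measurable]: "P \<in> borel_measurable borel"
    unfolding P_def by (rule borel_measurable_gauss_per_cvec[OF assms(1,2)])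
  have [measurable]: "weight L \<rho> \<phi> \<in> borel_measurable borel"
    using borel_measurable_integrable[OF assms(3)] by simp
  have "(\<lambda>x. (1 / of_nat M) * (\<Sum>i=1..M. P (x - X i) * \<phi> (cvec (X i))) -
      (LINT y|lborel. P (x - y) * weight L \<rho> \<phi> y)) \<in> borel_measurable borel"
    by measurable
  then show ?thesis
    by (simp add: op_diff_def empirical_op_def kernel_op_eq P_def cvec_diff)
qed

text \<open>
  The constant \<open>C\<close> is independent of \<open>\<phi>\<close>; this uniformity is what makes the operator norm finite.
\<close>

lemma op_diff_cvec_bounded:
  fixes \<rho> :: "real ^ 'n \<Rightarrow> real"
  assumes "\<eta> > 0" "L > 0" "torus_density L \<rho>"
  obtains C where
    "\<And>(\<phi> :: complex ^ 'n \<Rightarrow> complex) s x. continuous_on UNIV (\<lambda>y. \<phi> (cvec y)) \<Longrightarrow> (\<And>y. norm (\<phi> (cvec y)) \<le> s) \<Longrightarrow>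
      norm (op_diff L \<rho> M X \<eta> \<phi> (cvec x)) \<le> C * s"
proof -
  obtain B where B: "\<And>x :: real ^ 'n. norm (gauss_per \<eta> L (cvec x)) \<le> B"
    using bounded_gauss_per_cvec[OF assms(1,2)] by metis
  have B0: "B \<ge> 0" using B[of 0] norm_ge_zero order_trans by blast
  define I where "I = (LINT y|lborel. norm (indicator (fund_cube L) y * \<rho> y))"
  show ?thesis
  proof (rule that[of "B * (1 + I)"])
    fix \<phi> :: "complex ^ 'n \<Rightarrow> complex" and s and x :: "real ^ 'n"
    assume c: "continuous_on UNIV (\<lambda>y :: real ^ 'n. \<phi> (cvec y))"
      and s: "\<And>y :: real ^ 'n. norm (\<phi> (cvec y)) \<le> s"
    have s0: "s \<ge> 0" using s[of 0] norm_ge_zero order_trans by blast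
    note w = weight_bounds[OF assms(3) c s]
    have "norm (empirical_op L M X \<eta> \<phi> (cvec x)) \<le> B * s"
    proof -
      have "norm (\<Sum>i=1..M. gauss_per \<eta> L (cvec x - cvec (X i)) * \<phi> (cvec (X i))) \<le> (\<Sum>i=1..M. B * s)"
        using B s B0
        by (intro sum_norm_le) (auto simp: norm_mult cvec_diff[symmetric] intro!: mult_mono)
      then have "norm (empirical_op L M X \<eta> \<phi> (cvec x)) \<le> 1 / real M * (real M * (B * s))"
        unfolding empirical_op_def norm_mult by (intro mult_mono) (auto simp: norm_divide)
      also have "\<dots> \<le> B * s" using B0 s0 by (cases "M = 0") auto
      finally show ?thesis .
    qed
    moreover have "norm (kernel_op L \<rho> \<eta> \<phi> (cvec x)) \<le> B * (s * I)"
    proof -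
      have n: "norm (gauss_per \<eta> L (cvec x - cvec y) * weight L \<rho> \<phi> y) \<le>
          B * norm (weight L \<rho> \<phi> y)" for y
        unfolding norm_mult cvec_diff[symmetric] by (intro mult_right_mono B) auto
      have "norm (kernel_op L \<rho> \<eta> \<phi> (cvec x)) \<le>
          (LINT y|lborel. norm (gauss_per \<eta> L (cvec x - cvec y) * weight L \<rho> \<phi> y))"
        unfolding kernel_op_eq by (rule integral_norm_bound)
      also have "\<dots> \<le> (LINT y|lborel. B * norm (weight L \<rho> \<phi> y))"
        by (rule integral_mono') (use w(1) n B0 in auto)
      also have "\<dots> \<le> B * (s * I)"
        using w(2) B0 by (auto simp: I_def intro!: mult_left_mono)
      finally show ?thesis .
    qed
    ultimately show "norm (op_diff L \<rho> M X \<eta> \<phi> (cvec x)) \<le> B * (1 + I) * s"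
      using norm_triangle_ineq4[of "empirical_op L M X \<eta> \<phi> (cvec x)" "kernel_op L \<rho> \<eta> \<phi> (cvec x)"]
      by (simp add: op_diff_def algebra_simps)
  qed
qed

lemma op_diff_periodic:
  fixes \<phi> :: "complex ^ 'n \<Rightarrow> complex"
  shows "periodic_on L S (op_diff L \<rho> M X \<eta> \<phi>)"
proof -
  have "gauss_per \<eta> L (z + period L k - w) = gauss_per \<eta> L (z - w)" for z w :: "complex ^ 'n" and k
    using gauss_per_periodic[of \<eta> L "z - w" k] by (simp add: algebra_simps)
  then show ?thesis
    by (simp add: periodic_on_def op_diff_def empirical_op_def kernel_op_def)
qed

section \<open>Gaussian smoothing produces entire functions\<close>

lemma scaleR_eq_vector_smult: "r *\<^sub>R (v :: complex ^ 'n) = complex_of_real r *s v"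
  unfolding vec_eq_iff vector_scaleR_component vector_smult_component
  by (simp add: scaleR_conv_of_real)

text \<open>
  Differentiation under the integral sign. Here \<open>b\<close> is a pairing, complex-linear in its first argument, and \<open>W\<close>
  decays faster than any exponential. The candidate derivative is obtained by differentiating the exponential, and
  the remainder is quadratic in the increment because \<open>\<bar>exp u - 1 - u\<bar> \<le> \<bar>u\<bar>\<^sup>2 exp\<bar>u\<bar>\<close>.
\<close>

lemma laplace_transform_complex_differentiable:
  fixes b :: "complex ^ 'n \<Rightarrow> 'a::euclidean_space \<Rightarrow> complex" and W :: "'a \<Rightarrow> complex"
  assumes add: "\<And>v w x. b (v + w) x = b v x + b w x"
    and smult: "\<And>c v x. b (c *s v) x = c * b v x"
    and le: "\<And>v x. norm (b v x) \<le> K * norm v * norm x"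
    and meas [measurable]: "\<And>v. b v \<in> borel_measurable borel" "W \<in> borel_measurable borel"
    and int: "\<And>C. integrable lborel (\<lambda>x. exp (C * norm x) * norm (W x))"
    and K: "K \<ge> 0"
  shows "\<exists>D. ((\<lambda>z. LINT x|lborel. exp (b z x) * W x) has_derivative D) (at z) \<and>
    (\<forall>c v. D (c *s v) = c * D v)"
proof -
  let ?\<Phi> = "\<lambda>z. LINT x|lborel. exp (b z x) * W x"
  define D where "D v = (LINT x|lborel. b v x * exp (b z x) * W x)" for v
  have exp_le: "norm (exp (b w x)) \<le> exp (K * norm w * norm x)" for w x
    using norm_exp[of "b w x"] le[of w x] by (meson exp_le_cancel_iff order_trans)
  have int\<Phi>: "integrable lborel (\<lambda>x. exp (b w x) * W x)" for w
    by (rule Bochner_Integration.integrable_bound[OF int[of "K * norm w"]])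
      (auto simp: norm_mult simp del: norm_exp_eq_Re intro!: AE_I2 mult_right_mono exp_le)
  have le_exp: "norm x \<le> exp (norm x)" "(norm x)\<^sup>2 \<le> 2 * exp (norm x)" for x :: 'a
    using exp_ge_add_one_self[of "norm x"] exp_lower_Taylor_quadratic[of "norm x"] norm_ge_zero[of x]
    by linarith+
  have D_le: "norm (b v x * exp (b z x) * W x) \<le>
      K * norm v * (exp ((K * norm z + 1) * norm x) * norm (W x))" for v x
  proof -
    have "norm (b v x) * norm (exp (b z x)) \<le>
        (K * norm v * norm x) * exp (K * norm z * norm x)"
      using le K by (intro mult_mono exp_le) auto
    also have "\<dots> \<le> (K * norm v * exp (norm x)) * exp (K * norm z * norm x)"
      using K by (intro mult_right_mono mult_left_mono le_exp) auto
    also have "\<dots> = K * norm v * exp ((K * norm z + 1) * norm x)"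
      by (simp add: exp_add[symmetric] algebra_simps)
    finally have "norm (b v x) * norm (exp (b z x)) * norm (W x) \<le>
        K * norm v * exp ((K * norm z + 1) * norm x) * norm (W x)"
      by (rule mult_right_mono) auto
    then show ?thesis by (simp add: norm_mult mult.assoc)
  qed
  have intD: "integrable lborel (\<lambda>x. b v x * exp (b z x) * W x)" for v
    by (rule Bochner_Integration.integrable_bound[OF integrable_mult_right[OF
          int[of "K * norm z + 1"], of "K * norm v"]])
      (auto simp only: real_norm_def intro!: AE_I2 order_trans[OF D_le abs_ge_self], measurable)
  have D_add: "D (v + w) = D v + D w" for v w
    unfolding D_def using intD[of v] intD[of w]
    by (subst Bochner_Integration.integral_add[symmetric]) (auto simp: add algebra_simps)
  have D_smult: "D (c *s v) = c * D v" for c v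
    unfolding D_def by (simp add: smult mult.assoc)
  define J where "J = (LINT x|lborel. exp ((K * norm z + 1) * norm x) * norm (W x))"
  have "bounded_linear D"
  proof (rule bounded_linear_intro[where K="K * J"])
    show "D (r *\<^sub>R v) = r *\<^sub>R D v" for r v
      by (simp add: scaleR_eq_vector_smult D_smult scaleR_conv_of_real)
    show "norm (D v) \<le> norm v * (K * J)" for v
    proof -
      have "norm (D v) \<le> (LINT x|lborel. K * norm v * (exp ((K * norm z + 1) * norm x) * norm (W x)))"
        unfolding D_def using int[of "K * norm z + 1"] D_le
        by (intro Bochner_Integration.integral_norm_bound_integral intD integrable_mult_right) auto
      then show ?thesis by (simp add: J_def mult_ac)
    qed
  qed (rule D_add)
  \<comment> \<open>one \<open>K\<close> for the increment \<open>\<bar>v\<bar> \<le> 1\<close>, and 1 to absorb the factor \<open>\<bar>x\<bar>\<^sup>2 \<le> 2 exp \<bar>x\<bar>\<close>\<close>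
  define C where "C = K * norm z + K + 1"
  define I where "I = (LINT x|lborel. exp (C * norm x) * norm (W x))"
  have rem: "norm (?\<Phi> (z + v) - ?\<Phi> z - D v) \<le> (norm v)\<^sup>2 * (2 * K\<^sup>2 * I)" if v: "norm v \<le> 1" for v
  proof -
    have "?\<Phi> (z + v) - ?\<Phi> z - D v =
        (LINT x|lborel. exp (b (z + v) x) * W x - exp (b z x) * W x - b v x * exp (b z x) * W x)"
      unfolding D_def using int\<Phi> intD by simp
    also have "norm \<dots> \<le> (LINT x|lborel. (norm v)\<^sup>2 * (2 * K\<^sup>2) * (exp (C * norm x) * norm (W x)))"
    proof (rule Bochner_Integration.integral_norm_bound_integral)
      show "integrable lborel
          (\<lambda>x. exp (b (z + v) x) * W x - exp (b z x) * W x - b v x * exp (b z x) * W x)"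
        using int\<Phi> intD by (intro Bochner_Integration.integrable_diff) auto
      show "integrable lborel (\<lambda>x. (norm v)\<^sup>2 * (2 * K\<^sup>2) * (exp (C * norm x) * norm (W x)))"
        by (intro integrable_mult_right int)
      fix x
      have "norm (exp (b v x) - 1 - b v x) \<le> exp \<bar>Re (b v x)\<bar> * (norm (b v x))\<^sup>2"
        using Taylor_exp[of "b v x" 1] by (simp add: diff_diff_eq power2_eq_square)
      also have "\<dots> \<le> exp (K * norm x) * ((norm v)\<^sup>2 * K\<^sup>2 * (2 * exp (norm x)))"
      proof (intro mult_mono)
        have "\<bar>Re (b v x)\<bar> \<le> K * norm v * norm x"
          using abs_Re_le_cmod[of "b v x"] le[of v x] by linarith
        also have "\<dots> \<le> K * 1 * norm x"
          using v K by (intro mult_right_mono mult_left_mono) auto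
        finally show "exp \<bar>Re (b v x)\<bar> \<le> exp (K * norm x)" by simp
        have "(norm (b v x))\<^sup>2 \<le> (K * norm v * norm x)\<^sup>2" by (intro power_mono le) auto
        also have "\<dots> = (norm v)\<^sup>2 * K\<^sup>2 * (norm x)\<^sup>2" by (simp add: power_mult_distrib)
        also have "\<dots> \<le> (norm v)\<^sup>2 * K\<^sup>2 * (2 * exp (norm x))"
          by (intro mult_left_mono le_exp) auto
        finally show "(norm (b v x))\<^sup>2 \<le> (norm v)\<^sup>2 * K\<^sup>2 * (2 * exp (norm x))" .
      qed auto
      finally have "norm (exp (b z x)) * norm (exp (b v x) - 1 - b v x) \<le>
          exp (K * norm z * norm x) * (exp (K * norm x) * ((norm v)\<^sup>2 * K\<^sup>2 * (2 * exp (norm x))))"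
        by (intro mult_mono exp_le) auto
      also have "\<dots> = (norm v)\<^sup>2 * (2 * K\<^sup>2) * exp (C * norm x)"
        by (simp add: C_def exp_add algebra_simps)
      finally have "norm (exp (b z x)) * norm (exp (b v x) - 1 - b v x) * norm (W x) \<le>
          (norm v)\<^sup>2 * (2 * K\<^sup>2) * exp (C * norm x) * norm (W x)"
        by (rule mult_right_mono) auto
      moreover have "exp (b (z + v) x) * W x - exp (b z x) * W x - b v x * exp (b z x) * W x =
          exp (b z x) * (exp (b v x) - 1 - b v x) * W x"
        by (simp add: add exp_add algebra_simps)
      ultimately show "norm (exp (b (z + v) x) * W x - exp (b z x) * W x - b v x * exp (b z x) * W x)
          \<le> (norm v)\<^sup>2 * (2 * K\<^sup>2) * (exp (C * norm x) * norm (W x))"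
        by (simp add: norm_mult mult.assoc)
    qed
    finally show ?thesis by (simp only: I_def integral_mult_right_zero mult.assoc)
  qed
  have "((\<lambda>v. norm (?\<Phi> (z + v) - ?\<Phi> z - D v) / norm v) \<longlongrightarrow> 0) (at 0)"
  proof (rule Lim_null_comparison)
    show "\<forall>\<^sub>F v in at 0. norm (norm (?\<Phi> (z + v) - ?\<Phi> z - D v) / norm v) \<le> norm v * (2 * K\<^sup>2 * I)"
      unfolding eventually_at
    proof (intro exI[of _ 1] conjI ballI impI)
      fix v :: "complex ^ 'n"
      assume "v \<noteq> 0 \<and> dist v 0 < 1"
      then show "norm (norm (?\<Phi> (z + v) - ?\<Phi> z - D v) / norm v) \<le> norm v * (2 * K\<^sup>2 * I)"
        using rem[of v] by (simp add: pos_divide_le_eq power2_eq_square mult_ac)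
    qed simp
    show "((\<lambda>v :: complex ^ 'n. norm v * (2 * K\<^sup>2 * I)) \<longlongrightarrow> 0) (at 0)"
      by (rule tendsto_mult_left_zero[OF tendsto_norm_zero[OF tendsto_ident_at]])
  qed
  then have "(?\<Phi> has_derivative D) (at z)"
    using \<open>bounded_linear D\<close> by (simp add: has_derivative_at)
  then show ?thesis using D_smult by blast
qed

lemma norm_gauss_cvec:
  fixes x :: "real ^ 'n"
  shows "norm (gauss \<eta> (cvec x)) =
    (2 * pi * \<eta>) powr (- real CARD('n) / 2) * exp (- (norm x)\<^sup>2 / (2 * \<eta>))"
  unfolding gauss_cvec norm_of_real by simp

text \<open>
  A Gaussian absorbs any exponential at the price of doubling its variance:
  \<open>C t - t\<^sup>2 / (2\<eta>) \<le> C\<^sup>2 \<eta> - t\<^sup>2 / (4\<eta>)\<close>.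
\<close>

lemma integrable_exp_norm_mult_gauss:
  assumes "\<eta> > 0"
  shows "integrable lborel (\<lambda>x :: real ^ 'n. exp (C * norm x) * norm (gauss \<eta> (cvec x)))"
proof -
  let ?c = "\<lambda>\<eta>. (2 * pi * \<eta>) powr (- real CARD('n) / 2)"
  let ?A = "exp (C\<^sup>2 * \<eta>) * ?c \<eta> / ?c (2 * \<eta>)"
  have "gauss (2 * \<eta>) (0 - cvec x) = gauss (2 * \<eta>) (cvec x)" for x :: "real ^ 'n"
    by (simp add: gauss_def)
  then have "integrable lborel (\<lambda>x :: real ^ 'n. norm (gauss (2 * \<eta>) (cvec x)))"
    using has_bochner_integral_norm_gauss[of "2 * \<eta>" "0 :: complex ^ 'n"] assms
    by (simp add: has_bochner_integral_iff)
  then have "integrable lborel (\<lambda>x :: real ^ 'n. ?A * norm (gauss (2 * \<eta>) (cvec x)))"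
    by (rule integrable_mult_right)
  then show ?thesis
  proof (rule Bochner_Integration.integrable_bound)
    show "(\<lambda>x :: real ^ 'n. exp (C * norm x) * norm (gauss \<eta> (cvec x))) \<in> borel_measurable lborel"
      unfolding measurable_lborel2
      by (intro borel_measurable_continuous_onI continuous_intros assms)
    have "exp (C * norm x) * norm (gauss \<eta> (cvec x)) \<le> ?A * norm (gauss (2 * \<eta>) (cvec x))"
      for x :: "real ^ 'n"
    proof -
      \<comment> \<open>the difference of the two exponents is this square\<close>
      have "0 \<le> (norm x - 2 * \<eta> * C)\<^sup>2 / (4 * \<eta>)" using assms by simp
      also have "\<dots> = (norm x)\<^sup>2 / (4 * \<eta>) - C * norm x + C\<^sup>2 * \<eta>"
        using assms by (simp add: field_simps power2_eq_square)
      finally have "C * norm x + - (norm x)\<^sup>2 / (2 * \<eta>) \<le> C\<^sup>2 * \<eta> + - (norm x)\<^sup>2 / (2 * (2 * \<eta>))"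
        by (simp add: field_simps)
      then have "?c \<eta> * exp (C * norm x + - (norm x)\<^sup>2 / (2 * \<eta>)) \<le>
          ?c \<eta> * exp (C\<^sup>2 * \<eta> + - (norm x)\<^sup>2 / (2 * (2 * \<eta>)))"
        by (intro mult_left_mono) auto
      moreover have "?c (2 * \<eta>) \<noteq> 0" using assms by simp
      ultimately show ?thesis
        unfolding norm_gauss_cvec exp_add by (simp add: mult_ac)
    qed
    then show "AE x :: real ^ 'n in lborel. norm (exp (C * norm x) * norm (gauss \<eta> (cvec x))) \<le>
        norm (?A * norm (gauss (2 * \<eta>) (cvec x)))"
      by (intro AE_I2) (simp add: abs_mult)
  qed
qed

text \<open>
  Expanding \<open>(z - x)\<^sup>2\<close> writes the smoothing as the entire function \<open>exp(- z\<^sup>2 / (2\<eta>))\<close> times a Laplace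
  transform of the Gaussian times \<open>h\<close>.
\<close>

lemma gauss_smoothing_complex_differentiable:
  fixes h :: "real ^ 'n \<Rightarrow> complex" and z :: "complex ^ 'n"
  assumes "\<eta> > 0" and h [measurable]: "h \<in> borel_measurable borel" and B: "\<And>x. norm (h x) \<le> B"
  shows "\<exists>D. ((\<lambda>z. LINT x|lborel. gauss \<eta> (z - cvec x) * h x) has_derivative D) (at z) \<and>
    (\<forall>c v. D (c *s v) = c * D v)"
proof -
  define b :: "complex ^ 'n \<Rightarrow> real ^ 'n \<Rightarrow> complex"
    where "b v x = (\<Sum>i\<in>UNIV. v $ i * of_real (x $ i / \<eta>))" for v x
  define W where "W x = gauss \<eta> (cvec x) * h x" for x
  define G :: "complex ^ 'n \<Rightarrow> complex"
    where "G z = exp (- (\<Sum>i\<in>UNIV. (z $ i)\<^sup>2) / of_real (2 * \<eta>))" for z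
  have factor: "gauss \<eta> (z - cvec x) * h x = G z * (exp (b z x) * W x)" for z x
  proof -
    have "- (\<Sum>i\<in>UNIV. (z $ i - of_real (x $ i))\<^sup>2) / of_real (2 * \<eta>) =
        - (\<Sum>i\<in>UNIV. (z $ i)\<^sup>2) / of_real (2 * \<eta>) + b z x +
        - (\<Sum>i\<in>UNIV. (of_real (x $ i))\<^sup>2) / of_real (2 * \<eta>)"
      using assms(1) unfolding b_def sum_negf[symmetric] sum_divide_distrib sum.distrib[symmetric]
      by (intro sum.cong) (simp_all add: field_simps power2_eq_square)
    then have "exp (- (\<Sum>i\<in>UNIV. (z $ i - of_real (x $ i))\<^sup>2) / of_real (2 * \<eta>)) =
        G z * exp (b z x) * exp (- (\<Sum>i\<in>UNIV. (of_real (x $ i))\<^sup>2) / of_real (2 * \<eta>))"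
      unfolding G_def by (simp only: exp_add)
    then show ?thesis by (simp add: gauss_def W_def)
  qed
  have W_meas [measurable]: "W \<in> borel_measurable borel"
  proof -
    have [measurable]: "(\<lambda>x. gauss \<eta> (cvec x)) \<in> borel_measurable borel"
      by (intro borel_measurable_continuous_onI continuous_intros assms)
    show ?thesis unfolding W_def by measurable
  qed
  have "\<exists>D. ((\<lambda>z. LINT x|lborel. exp (b z x) * W x) has_derivative D) (at z) \<and>
    (\<forall>c v. D (c *s v) = c * D v)"
  proof (rule laplace_transform_complex_differentiable[where K="real CARD('n) / \<eta>"])
    show "b (v + w) x = b v x + b w x" for v w x
      unfolding b_def vector_add_component distrib_right sum.distrib ..
    show "b (c *s v) x = c * b v x" for c v x
      by (simp add: b_def sum_distrib_left mult.assoc)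
    show "norm (b v x) \<le> real CARD('n) / \<eta> * norm v * norm x" for v x
    proof -
      have "norm (b v x) \<le> (\<Sum>i\<in>(UNIV :: 'n set). norm v * (norm x / \<eta>))"
        unfolding b_def
      proof (rule sum_norm_le)
        fix i
        show "norm (v $ i * of_real (x $ i / \<eta>)) \<le> norm v * (norm x / \<eta>)"
          unfolding norm_mult norm_of_real using assms(1)
            Finite_Cartesian_Product.norm_nth_le[of v i] Finite_Cartesian_Product.norm_nth_le[of x i]
          by (intro mult_mono) (auto simp: divide_right_mono)
      qed
      then show ?thesis by simp
    qed
    show "b v \<in> borel_measurable borel" for v
      unfolding b_def by measurable
    show "integrable lborel (\<lambda>x. exp (C * norm x) * norm (W x))" for C
    proof (rule Bochner_Integration.integrable_bound)
      show "integrable lborel (\<lambda>x :: real ^ 'n. B * (exp (C * norm x) * norm (gauss \<eta> (cvec x))))"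
        by (intro integrable_mult_right integrable_exp_norm_mult_gauss assms)
      show "(\<lambda>x. exp (C * norm x) * norm (W x)) \<in> borel_measurable lborel" by measurable
      have "norm (exp (C * norm x) * norm (W x)) \<le> norm (B * (exp (C * norm x) * norm (gauss \<eta> (cvec x))))"
        for x
      proof -
        have "norm (h x) \<le> \<bar>B\<bar>" using B[of x] by linarith
        then have "exp (C * norm x) * norm (gauss \<eta> (cvec x)) * norm (h x) \<le>
            exp (C * norm x) * norm (gauss \<eta> (cvec x)) * \<bar>B\<bar>"
          by (intro mult_left_mono) auto
        then show ?thesis by (simp add: W_def norm_mult abs_mult mult_ac)
      qed
      then show "AE x in lborel. norm (exp (C * norm x) * norm (W x)) \<le>
          norm (B * (exp (C * norm x) * norm (gauss \<eta> (cvec x))))"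
        by (intro AE_I2)
    qed
  qed (use assms in auto)
  then obtain D where D: "((\<lambda>z. LINT x|lborel. exp (b z x) * W x) has_derivative D) (at z)"
    "\<And>c v. D (c *s v) = c * D v" by blast
  define E where "E v = G z * (- (\<Sum>i\<in>UNIV. 2 * (z $ i) * (v $ i)) / of_real (2 * \<eta>))" for v
  have G_deriv: "(G has_derivative E) (at z)"
  proof -
    have "((\<lambda>z. - (\<Sum>i\<in>UNIV. (z $ i)\<^sup>2) / of_real (2 * \<eta>)) has_derivative
        (\<lambda>v. - (\<Sum>i\<in>UNIV. 2 * (z $ i) * (v $ i)) / of_real (2 * \<eta>))) (at z)"
      unfolding divide_inverse power2_eq_square
      by (auto intro!: derivative_eq_intros bounded_linear.has_derivative[OF bounded_linear_vec_nth]
          simp: fun_eq_iff algebra_simps sum.distrib sum_distrib_left)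
    from has_derivative_compose[OF this DERIV_exp[unfolded has_field_derivative_def]]
    show ?thesis by (simp add: G_def[abs_def] E_def[abs_def])
  qed
  have "((\<lambda>z. G z * (LINT x|lborel. exp (b z x) * W x)) has_derivative
      (\<lambda>v. G z * D v + E v * (LINT x|lborel. exp (b z x) * W x))) (at z)"
    by (rule has_derivative_mult[OF G_deriv D(1)])
  moreover have "E (c *s v) = c * E v" for c v
    by (simp add: E_def sum_distrib_left mult_ac)
  ultimately show ?thesis
    unfolding factor by (intro exI conjI) (auto simp: D(2) algebra_simps)
qed

section \<open>The operator difference on the strip\<close>

lemma cvec_in_strip: "\<zeta> \<ge> 0 \<Longrightarrow> cvec x \<in> strip \<zeta>"
  by (simp add: strip_def)

lemma H_inf_cvec:
  fixes \<phi> :: "complex ^ 'n \<Rightarrow> complex"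
  assumes "\<phi> \<in> H_inf L \<zeta>" "\<zeta> \<ge> 0"
  shows H_inf_continuous_cvec: "continuous_on UNIV (\<lambda>y. \<phi> (cvec y))"
    and H_inf_periodic_cvec: "periodic_on L UNIV (\<lambda>y. \<phi> (cvec y))"
proof -
  show "continuous_on UNIV (\<lambda>y. \<phi> (cvec y))"
    by (rule continuous_on_compose2[of "strip \<zeta>" \<phi>])
      (use assms cvec_in_strip in \<open>auto simp: H_inf_def intro!: continuous_intros\<close>)
  show "periodic_on L UNIV (\<lambda>y. \<phi> (cvec y))"
    using assms cvec_in_strip by (auto simp: H_inf_def periodic_on_def cvec_add cvec_period)
qed

text \<open>
  The operator difference is a Gaussian smoothing of the bounded measurable function that the difference at half
  the scale defines on the real points.
\<close>

lemma op_diff_complex_differentiable: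
  fixes \<phi> :: "complex ^ 'n \<Rightarrow> complex"
  assumes "\<epsilon> > 0" "L > 0" "torus_density L \<rho>"
    and c: "continuous_on UNIV (\<lambda>y. \<phi> (cvec y))" and B: "\<And>y. norm (\<phi> (cvec y)) \<le> B"
  shows "\<exists>D. (op_diff L \<rho> M X \<epsilon> \<phi> has_derivative D) (at z) \<and> (\<forall>c v. D (c *s v) = c * D v)"
proof -
  have e: "\<epsilon> / 2 > 0" using assms by simp
  note w = integrable_weight[OF assms(3) c B]
  obtain C where "\<And>x. norm (op_diff L \<rho> M X (\<epsilon> / 2) \<phi> (cvec x)) \<le> C * B"
    using op_diff_cvec_bounded[OF e assms(2,3)] c B by metis
  from gauss_smoothing_complex_differentiable[OF e op_diff_cvec_measurable[OF e assms(2) w] this]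
  show ?thesis unfolding op_diff_smoothing[OF assms(1,2) w, symmetric] .
qed

theorem theorem3p7:
  fixes L Z0 \<epsilon> \<zeta> :: real
    and \<rho> :: "real ^ 'n \<Rightarrow> real"
    and M :: nat
    and X :: "nat \<Rightarrow> real ^ 'n"
    and \<delta> :: ennreal
  assumes "L > 0"
    and "torus_density L \<rho>"
    and "\<exists>c>0. AE y in lborel. c \<le> \<rho> y"
    and "\<exists>C. AE y in lborel. \<rho> y \<le> C"
    and "M \<ge> 1"
    and "Z0 > 0"
    and "\<epsilon> > 0"
    and "\<zeta> = Z0 * sqrt \<epsilon>"
    and "\<delta> = op_norm (H_inf L \<zeta>) (strip \<zeta>) UNIV (\<lambda>\<phi> x. op_diff L \<rho> M X (\<epsilon> / 2) \<phi> (cvec x))"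
  shows "(\<forall>\<phi>\<in>H_inf L \<zeta>. (\<lambda>x. op_diff L \<rho> M X (\<epsilon> / 2) \<phi> (cvec x)) \<in> C0_torus L)
    \<and> \<delta> < \<infinity>
    \<and> (\<forall>\<phi>\<in>H_inf L \<zeta>. op_diff L \<rho> M X \<epsilon> \<phi> \<in> H_inf L \<zeta>)
    \<and> op_norm (H_inf L \<zeta>) (strip \<zeta>) (strip \<zeta>) (op_diff L \<rho> M X \<epsilon>)
        \<le> ennreal (exp (2 * real CARD('n) * Z0\<^sup>2)) * \<delta>"
proof -
  have e: "\<epsilon> / 2 > 0" and \<zeta>: "\<zeta> \<ge> 0" using assms by simp_all
  let ?h = "\<lambda>\<phi> x. op_diff L \<rho> M X (\<epsilon> / 2) \<phi> (cvec x)"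
  let ?H1 = "{\<phi> \<in> H_inf L \<zeta>. sup_norm (strip \<zeta>) \<phi> \<le> 1}"
  have \<delta>: "\<delta> = (SUP \<phi>\<in>?H1. sup_norm UNIV (?h \<phi>))"
    unfolding assms(9) op_norm_def ..
  have entire: "\<exists>D. (op_diff L \<rho> M X \<eta> \<phi> has_derivative D) (at z) \<and> (\<forall>c v. D (c *s v) = c * D v)"
    if \<phi>: "\<phi> \<in> H_inf L \<zeta>" and \<eta>: "\<eta> > 0" for \<phi> \<eta> z
  proof -
    obtain B where "\<And>y. norm (\<phi> (cvec y)) \<le> B"
      using bounded_periodic[OF assms(1) H_inf_periodic_cvec[OF \<phi> \<zeta>] H_inf_continuous_cvec[OF \<phi> \<zeta>]]
      by metis
    then show ?thesis
      by (rule op_diff_complex_differentiable[OF \<eta> assms(1,2) H_inf_continuous_cvec[OF \<phi> \<zeta>]])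
  qed
  then have cont: "continuous_on UNIV (op_diff L \<rho> M X \<eta> \<phi>)" if "\<phi> \<in> H_inf L \<zeta>" "\<eta> > 0" for \<phi> \<eta>
    using that by (metis continuous_at_imp_continuous_on has_derivative_continuous)
  have hcont: "continuous_on UNIV (?h \<phi>)" if "\<phi> \<in> H_inf L \<zeta>" for \<phi>
    by (rule continuous_on_compose2[OF cont[OF that e]]) (auto intro!: continuous_intros)
  have C0: "?h \<phi> \<in> C0_torus L" if "\<phi> \<in> H_inf L \<zeta>" for \<phi>
    using hcont[OF that] op_diff_periodic[of L UNIV \<rho> M X "\<epsilon> / 2" \<phi>]
    by (simp add: C0_torus_def periodic_on_def cvec_add cvec_period)
  have H: "op_diff L \<rho> M X \<epsilon> \<phi> \<in> H_inf L \<zeta>" if "\<phi> \<in> H_inf L \<zeta>" for \<phi>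
    unfolding H_inf_def mv_holomorphic_on_def
  proof (intro CollectI conjI ballI)
    show "continuous_on (strip \<zeta>) (op_diff L \<rho> M X \<epsilon> \<phi>)"
      using cont[OF that assms(7)] by (rule continuous_on_subset) simp
    show "\<exists>D. (op_diff L \<rho> M X \<epsilon> \<phi> has_derivative D) (at z within interior (strip \<zeta>)) \<and>
        (\<forall>c v. D (c *s v) = c * D v)" for z
      using entire[OF that assms(7), of z] has_derivative_at_withinI by blast
  qed (rule op_diff_periodic)
  obtain C where C:
    "\<And>(\<phi> :: complex ^ 'n \<Rightarrow> complex) s x. continuous_on UNIV (\<lambda>y. \<phi> (cvec y)) \<Longrightarrow>
      (\<And>y. norm (\<phi> (cvec y)) \<le> s) \<Longrightarrow> norm (?h \<phi> x) \<le> C * s"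
    using op_diff_cvec_bounded[OF e assms(1,2)] by metis
  have "sup_norm UNIV (?h \<phi>) \<le> ennreal C" if \<phi>: "\<phi> \<in> ?H1" for \<phi>
  proof -
    have "norm (\<phi> (cvec y)) \<le> 1" for y
    proof -
      have "ennreal (norm (\<phi> (cvec y))) \<le> sup_norm (strip \<zeta>) \<phi>"
        unfolding sup_norm_def using \<phi> \<zeta> by (intro SUP_upper cvec_in_strip) auto
      also have "\<dots> \<le> 1" using \<phi> by simp
      finally show ?thesis by simp
    qed
    then have "norm (?h \<phi> x) \<le> C" for x
      using C[of \<phi> 1 x] H_inf_continuous_cvec[of \<phi> L \<zeta>] \<phi> \<zeta> by simp
    then show ?thesis unfolding sup_norm_def by (intro SUP_least ennreal_leI)
  qed
  then have "\<delta> \<le> ennreal C" unfolding \<delta> by (rule SUP_least)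
  then have fin: "\<delta> < \<infinity>" using le_less_trans ennreal_less_top by fastforce
  define s where "s = enn2real \<delta>"
  have s: "\<delta> = ennreal s" "s \<ge> 0" using fin by (simp_all add: s_def)
  have "ennreal (norm (op_diff L \<rho> M X \<epsilon> \<phi> z)) \<le> ennreal (exp (2 * real CARD('n) * Z0\<^sup>2)) * \<delta>"
    if \<phi>: "\<phi> \<in> ?H1" and z: "z \<in> strip \<zeta>" for \<phi> z
  proof -
    have \<phi>': "\<phi> \<in> H_inf L \<zeta>" using \<phi> by simp
    have hs: "norm (?h \<phi> x) \<le> s" for x
    proof -
      have "ennreal (norm (?h \<phi> x)) \<le> sup_norm UNIV (?h \<phi>)"
        unfolding sup_norm_def by (rule SUP_upper) simp
      also have "\<dots> \<le> \<delta>" unfolding \<delta> by (rule SUP_upper[OF \<phi>])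
      finally show ?thesis using s by simp
    qed
    obtain B where B: "\<And>y. norm (\<phi> (cvec y)) \<le> B"
      using bounded_periodic[OF assms(1) H_inf_periodic_cvec[OF \<phi>' \<zeta>] H_inf_continuous_cvec[OF \<phi>' \<zeta>]]
      by metis
    note w = integrable_weight[OF assms(2) H_inf_continuous_cvec[OF \<phi>' \<zeta>] B]
    have "norm (op_diff L \<rho> M X \<epsilon> \<phi> z) \<le> exp ((\<Sum>i\<in>UNIV. (Im (z $ i))\<^sup>2) / (2 * (\<epsilon> / 2))) * s"
      unfolding op_diff_smoothing[OF assms(7,1) w]
      by (rule norm_gauss_smoothing_le[OF e borel_measurable_continuous_onI[OF hcont[OF \<phi>']] hs])
    also have "\<dots> \<le> exp (2 * real CARD('n) * Z0\<^sup>2) * s"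
    proof -
      have "(Im (z $ i))\<^sup>2 \<le> Z0\<^sup>2 * \<epsilon>" for i
      proof -
        have "\<bar>Im (z $ i)\<bar> \<le> \<zeta>" using z by (auto simp: strip_def abs_le_iff minus_le_iff)
        then have "(Im (z $ i))\<^sup>2 \<le> \<zeta>\<^sup>2" using \<zeta> by (simp add: abs_le_square_iff[symmetric])
        then show ?thesis using assms(7,8) by (simp add: power_mult_distrib)
      qed
      then have "(\<Sum>i\<in>UNIV. (Im (z $ i))\<^sup>2) \<le> (\<Sum>i\<in>(UNIV :: 'n set). Z0\<^sup>2 * \<epsilon>)"
        by (intro sum_mono)
      then have "(\<Sum>i\<in>UNIV. (Im (z $ i))\<^sup>2) / (2 * (\<epsilon> / 2)) \<le> real CARD('n) * Z0\<^sup>2"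
        using assms(7) by (simp add: divide_le_eq mult.assoc)
      also have "\<dots> \<le> 2 * real CARD('n) * Z0\<^sup>2" by simp
      finally show ?thesis using s(2) by (intro mult_right_mono) auto
    qed
    finally show ?thesis by (simp add: s ennreal_mult[symmetric])
  qed
  then have "op_norm (H_inf L \<zeta>) (strip \<zeta>) (strip \<zeta>) (op_diff L \<rho> M X \<epsilon>)
      \<le> ennreal (exp (2 * real CARD('n) * Z0\<^sup>2)) * \<delta>"
    unfolding op_norm_def sup_norm_def[of "strip \<zeta>" "op_diff _ _ _ _ _ _"] by (intro SUP_least)
  then show ?thesis using C0 fin H by blast
qed

end
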